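(* Let $k\ge 2$ be an integer, let $T$ be the infinite rooted $k$-ary tree, let $p>1$ and let $u,v$ be weights on $T$. Assume that there exist real numbers $0<\beta<1$ and $\beta\le\alpha<p$ such that, for all finite sets $E,F\subset T$ and all integers $r\ge 0$, $$\sum_{x\in E}\ \sum_{\substack{y\in F\\ d(x,y)=r}} u(y)\ \lesssim\ k^{r\beta}\,v(E)^{\frac{\alpha}{p}}\,u(F)^{1-\frac{\alpha}{p}}.$$ Then for all functions $f$ on $T$ $$\|Mf\|_{L^{\frac{\beta}{\alpha}p,\infty}(u)}\lesssim\|f\|_{L^{\frac{\beta}{\alpha}p}(v)}.$$ Furthermore, if $\beta<\alpha$, then for all functions $f$ on $T$ $$\|Mf\|_{L^{p}(u)}\lesssim\|f\|_{L^{p}(v)}$$ and also $$\|Mf\|_{L^{p'}(\sigma_{u,p})}\lesssim\|f\|_{L^{p'}(\sigma_{v,p})},$$ where $\sigma_{\rho,p}=\rho^{-\frac{1}{p-1}}$ for a weight $\rho$, and $p'=\frac{p}{p-1}$.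
   Context: For an integer $k\ge2$, $T$ denotes (the vertex set of) the infinite rooted $k$-ary tree, in which every vertex has exactly $k$ children; $d(x,y)$ is the number of edges on the unique path between $x$ and $y$. $|A|$ is the cardinality of $A$ and $B(x,r)=\{y\in T: d(x,y)\le r\}$. The centered maximal function is $Mf(x)=\sup_{r\in\mathbb{N}\cup\{0\}}\frac{1}{|B(x,r)|}\sum_{y\in B(x,r)}|f(y)|$. A weight is a function $w:T\to(0,\infty)$, and $w(A)=\sum_{x\in A}w(x)$ for $A\subset T$. For $0<q<\infty$, $\|f\|_{L^q(w)}=\left(\sum_{x\in T}|f(x)|^q w(x)\right)^{1/q}$ and $\|f\|_{L^{q,\infty}(w)}=\sup_{\lambda>0}\lambda\, w(\{x\in T:|f(x)|>\lambda\})^{1/q}$. The notation $A\lesssim B$ means $A\le CB$ for a finite constant $C$ independent of the varying objects (in the hypothesis: of $E,F,r$; in the conclusions: of $f$).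
   Formalization: In the last estimate the two weights are exchanged: it is proved that the norm of Mf in L^{p'}(σ_{v,p}) is ≲ the norm of f in L^{p'}(σ_{u,p}); the printed order fails, e.g. for p=2, α=1, β=1/2, u=2^{-n-1} along an enumeration of T, v=1/u. *)

theory Defs
  imports "HOL-Analysis.Analysis"
begin

section \<open>The infinite rooted k-ary tree\<close>

text \<open>
  A vertex is the list of child indices met on the way down from the root \<^term>\<open>[]\<close>, the most
  recent one first; the children of \<open>x\<close> are \<open>i # x\<close> for \<open>i < k\<close>. Functions and weights
  on the tree are functions on \<^typ>\<open>nat list\<close>, whose values off \<open>ktree k\<close> are never used.
\<close>

definition ktree :: "nat \<Rightarrow> nat list set" where
  "ktree k = lists {..<k}"

definition tree_adj :: "nat list \<Rightarrow> nat list \<Rightarrow> bool" where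
  "tree_adj x y \<longleftrightarrow> (\<exists>i. y = i # x) \<or> (\<exists>i. x = i # y)"

definition tree_path :: "nat \<Rightarrow> nat list \<Rightarrow> nat list list \<Rightarrow> nat list \<Rightarrow> bool" where
  "tree_path k x p y \<longleftrightarrow>
     p \<noteq> [] \<and> hd p = x \<and> last p = y \<and> set p \<subseteq> ktree k \<and> distinct p \<and> successively tree_adj p"

definition tree_dist :: "nat \<Rightarrow> nat list \<Rightarrow> nat list \<Rightarrow> nat" where
  "tree_dist k x y = length (THE p. tree_path k x p y) - 1"

definition tree_ball :: "nat \<Rightarrow> nat list \<Rightarrow> nat \<Rightarrow> nat list set" where
  "tree_ball k x r = {y \<in> ktree k. tree_dist k x y \<le> r}"

text \<open>The description in \<open>tree_dist\<close> is proper: the path exists and is unique.\<close>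

lemma tree_path_exists:
  assumes "x \<in> ktree k" "y \<in> ktree k"
  shows "\<exists>p. tree_path k x p y"
proof -
  have up: "\<exists>p. tree_path k (i # x) p y" if "tree_path k x p y" "i # x \<in> ktree k" for i x y p
  proof (cases "i # x \<in> set p")
    case True
    then obtain as bs where "p = as @ (i # x) # bs" by (meson split_list)
    with that have "tree_path k (i # x) ((i # x) # bs) y"
      by (auto simp: tree_path_def successively_append_iff)
    then show ?thesis by blast
  next
    case False
    with that have "tree_path k (i # x) ((i # x) # p) y"
      by (auto simp: tree_path_def successively_Cons tree_adj_def)
    then show ?thesis by blast
  qed
  have down: "\<exists>p. tree_path k y p x" if "tree_path k x p y" for x y p
  proof -
    have "tree_path k y (rev p) x"
      using that by (auto simp: tree_path_def hd_rev last_rev successively_rev tree_adj_def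
          elim!: successively_mono)
    then show ?thesis by blast
  qed
  have root: "\<exists>p. tree_path k x p []" if "x \<in> ktree k" for x
    using that
  proof (induction x)
    case Nil
    have "tree_path k [] [[]] []" by (simp add: tree_path_def ktree_def)
    then show ?case by blast
  next
    case (Cons i x)
    then have "x \<in> ktree k" by (simp add: ktree_def)
    with Cons show ?case using up by blast
  qed
  show ?thesis
    using assms(1)
  proof (induction x)
    case Nil
    then show ?case using root[OF assms(2)] down by blast
  next
    case (Cons i x)
    then have "x \<in> ktree k" by (simp add: ktree_def)
    with Cons show ?case using up by blast
  qed
qed

lemma tree_path_unique:
  assumes "tree_path k x p y" "tree_path k x q y"
  shows "p = q"
proof -
  define below where "below c = {zs @ c |zs. True}" for c :: "nat list"
  have in_below: "last p \<in> below (i # x)"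
    if "successively tree_adj p" "p \<noteq> []" "hd p \<in> below (i # x)" "x \<notin> set p" for p i x
    using that
  proof (induction p)
    case (Cons a p)
    show ?case
    proof (cases p)
      case Nil
      with Cons.prems show ?thesis by simp
    next
      case (Cons b bs)
      from Cons.prems Cons have ab: "tree_adj a b" "a \<in> below (i # x)" "b \<noteq> x" by auto
      then obtain zs where a: "a = zs @ i # x" by (auto simp: below_def)
      have "b \<in> below (i # x)"
      proof (cases zs)
        case Nil
        with ab a have "b = [] @ i # x \<or> (\<exists>j. b = [j] @ i # x)" by (auto simp: tree_adj_def)
        then show ?thesis unfolding below_def by blast
      next
        case (Cons c cs)
        with ab a have "b = cs @ i # x \<or> (\<exists>j. b = (j # zs) @ i # x)"
          by (auto simp: tree_adj_def)
        then show ?thesis unfolding below_def by blast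
      qed
      with Cons Cons.prems Cons.IH show ?thesis by auto
    qed
  qed simp
  have not_below: "last p \<notin> below x"
    if "successively tree_adj p" "p \<noteq> []" "hd p \<notin> below x" "x \<notin> set p" for p x
    using that
  proof (induction p)
    case (Cons a p)
    show ?case
    proof (cases p)
      case Nil
      with Cons.prems show ?thesis by simp
    next
      case (Cons b bs)
      from Cons.prems Cons have ab: "tree_adj a b" "a \<notin> below x" "b \<noteq> x" by auto
      have "b \<notin> below x"
      proof
        assume "b \<in> below x"
        then obtain zs where b: "b = zs @ x" by (auto simp: below_def)
        with ab(3) obtain j ws where "zs = j # ws" by (cases zs) auto
        with b ab(1,2) show False
          by (auto simp: below_def tree_adj_def)
      qed
      with Cons Cons.prems Cons.IH show ?thesis by auto
    qed
  qed simp
  have next_vertex: "a = b"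
    if "tree_path k x (x # a # p) y" "tree_path k x (x # b # q) y" for x y a b p q
  proof -
    have s: "successively tree_adj (a # p)" "successively tree_adj (b # q)"
      "x \<notin> set (a # p)" "x \<notin> set (b # q)" "last (a # p) = y" "last (b # q) = y"
      "tree_adj x a" "tree_adj x b"
      using that by (auto simp: tree_path_def)
    have child: "y \<in> below (i # x)" if "c = i # x" "successively tree_adj (c # r)"
      "x \<notin> set (c # r)" "last (c # r) = y" for i c r
      using in_below[of "c # r" i x] that by (auto simp: below_def)
    have parent: "y \<notin> below x" if "x = i # c" "successively tree_adj (c # r)"
      "x \<notin> set (c # r)" "last (c # r) = y" for i c r
    proof -
      have "c \<notin> below x"
      proof
        assume "c \<in> below x"
        then obtain zs where "c = zs @ i # c" using \<open>x = i # c\<close> by (auto simp: below_def)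
        then have "length c = length (zs @ i # c)" by metis
        then show False by simp
      qed
      with not_below[of "c # r" x] that show ?thesis by auto
    qed
    have sub: "below (i # x) \<subseteq> below x" for i
      by (auto simp: below_def)
    have disj: "i = j" if "y \<in> below (i # x)" "y \<in> below (j # x)" for i j
    proof -
      from that obtain zs ws where "zs @ i # x = ws @ j # x" by (auto simp: below_def)
      then have "(zs @ [i]) @ x = (ws @ [j]) @ x" by simp
      then show ?thesis by (metis append_same_eq last_snoc)
    qed
    consider i j where "a = i # x" "b = j # x" | i j where "a = i # x" "x = j # b"
      | i j where "x = i # a" "b = j # x" | i j where "x = i # a" "x = j # b"
      using s(7,8) by (auto simp: tree_adj_def)
    then show ?thesis
    proof cases
      case 1
      from child[OF 1(1) s(1,3,5)] child[OF 1(2) s(2,4,6)] disj have "i = j" by blast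
      with 1 show ?thesis by simp
    next
      case 2
      from child[OF 2(1) s(1,3,5)] parent[OF 2(2) s(2,4,6)] sub[of i] show ?thesis by blast
    next
      case 3
      from parent[OF 3(1) s(1,3,5)] child[OF 3(2) s(2,4,6)] sub[of j] show ?thesis by blast
    next
      case 4
      then show ?thesis by simp
    qed
  qed
  show ?thesis
    using assms
  proof (induction p arbitrary: x q)
    case Nil
    then show ?case by (simp add: tree_path_def)
  next
    case (Cons c p)
    have c: "c = x" using Cons.prems by (simp add: tree_path_def)
    from Cons.prems obtain q' where q: "q = x # q'" by (cases q) (auto simp: tree_path_def)
    show ?case
    proof (cases "x = y")
      case True
      have "p = []" using Cons.prems(1) c True
        by (auto simp: tree_path_def split: if_splits)
      moreover have "q' = []" using Cons.prems(2) q True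
        by (auto simp: tree_path_def split: if_splits)
      ultimately show ?thesis using c q by simp
    next
      case False
      obtain a p' where p: "p = a # p'"
        using Cons.prems(1) c False by (cases p) (auto simp: tree_path_def)
      obtain b q'' where q': "q' = b # q''"
        using Cons.prems(2) q False by (cases q') (auto simp: tree_path_def)
      have ab: "a = b" using next_vertex Cons.prems c q p q' by metis
      have "tree_path k a p y" "tree_path k a q' y"
        using Cons.prems c q p q' ab by (auto simp: tree_path_def)
      then have "p = q'" by (rule Cons.IH)
      with c q show ?thesis by simp
    qed
  qed
qed

lemma tree_dist_eq: "tree_path k x p y \<Longrightarrow> tree_dist k x y = length p - 1"
  unfolding tree_dist_def by (metis the_equality tree_path_unique)


section \<open>The maximal function, weights and norms\<close>

text \<open>Averages are finite, but their supremum need not be, so \<open>maximal k f\<close> is extended valued.\<close>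

definition maximal :: "nat \<Rightarrow> (nat list \<Rightarrow> complex) \<Rightarrow> nat list \<Rightarrow> ennreal" where
  "maximal k f x =
     (SUP r. ennreal ((\<Sum>y\<in>tree_ball k x r. cmod (f y)) / real (card (tree_ball k x r))))"

definition is_weight :: "nat \<Rightarrow> (nat list \<Rightarrow> real) \<Rightarrow> bool" where
  "is_weight k w \<longleftrightarrow> (\<forall>x\<in>ktree k. 0 < w x)"

text \<open>The measure \<open>w(A) = (\<Sum>x\<in>A. w x)\<close> for arbitrary, possibly infinite, sets of vertices.\<close>

definition weight_measure :: "nat \<Rightarrow> (nat list \<Rightarrow> real) \<Rightarrow> nat list measure" where
  "weight_measure k w = density (count_space (ktree k)) (\<lambda>x. ennreal (w x))"

text \<open>Positive real powers on \<open>[0,\<infinity>]\<close>; only used with exponents \<open>a > 0\<close>.\<close>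

definition ennpow :: "ennreal \<Rightarrow> real \<Rightarrow> ennreal" where
  "ennpow t a = (if t = top then top else ennreal (enn2real t powr a))"

text \<open>
  Both (quasi-)norms take the modulus \<open>g = |f|\<close> as argument, so that they apply to functions and
  to maximal functions alike.
\<close>

definition Lq_norm :: "nat \<Rightarrow> (nat list \<Rightarrow> real) \<Rightarrow> real \<Rightarrow> (nat list \<Rightarrow> ennreal) \<Rightarrow> ennreal" where
  "Lq_norm k w q g = ennpow (\<integral>\<^sup>+x. ennpow (g x) q \<partial>weight_measure k w) (1 / q)"

definition weak_Lq_norm :: "nat \<Rightarrow> (nat list \<Rightarrow> real) \<Rightarrow> real \<Rightarrow> (nat list \<Rightarrow> ennreal) \<Rightarrow> ennreal" where
  "weak_Lq_norm k w q g =
     (SUP t\<in>{0<..}. ennreal t *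
        ennpow (emeasure (weight_measure k w) {x \<in> ktree k. ennreal t < g x}) (1 / q))"

text \<open>
  The weight \<open>\<sigma>\<^bsub>\<rho>,p\<^esub> = \<rho>\<^bsup>-1/(p-1)\<^esup>\<close>. Passing from \<open>L\<^bsup>p\<^esup>(v) \<rightarrow> L\<^bsup>p\<^esup>(u)\<close> to the dual estimate exchanges the
  weights: the maximal operator maps \<open>L\<^bsup>p'\<^esup>(\<sigma>\<^bsub>u,p\<^esub>)\<close> to \<open>L\<^bsup>p'\<^esup>(\<sigma>\<^bsub>v,p\<^esub>)\<close>. The opposite
  direction fails in general: testing it on point masses would give \<open>v \<le> C u\<close>, but for an enumeration
  \<open>n(x)\<close> of the tree \<open>u x = 2\<^bsup>-n(x)-1\<^esup>\<close>, \<open>v = 1 / u\<close>, \<open>p = 2\<close>, \<open>\<alpha> = 1\<close>, \<open>\<beta> = 1/2\<close> satisfy the spherical condition.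
\<close>

definition dual_weight :: "(nat list \<Rightarrow> real) \<Rightarrow> real \<Rightarrow> nat list \<Rightarrow> real" where
  "dual_weight \<rho> p x = \<rho> x powr (- 1 / (p - 1))"

end

theory Submission
  imports Defs
begin

text \<open>
  Balls of radius \<open>r\<close> have about \<open>k\<^sup>r\<close> points, so \<open>M f \<le> 2 sup\<^sub>r S\<^sub>r |f|\<close>, where \<open>S\<^sub>r\<close> sums over the sphere
  of radius \<open>r\<close> and divides by \<open>k\<^sup>r\<close>. Put \<open>q = \<beta> p / \<alpha>\<close>. If every point of \<open>F\<close> sees at least \<open>m\<close> points of \<open>E\<close>
  at distance \<open>r\<close>, the hypothesis becomes \<open>u(F) \<le> (C k\<^bsup>r\<beta>\<^esup> / m)\<^bsup>p/\<alpha>\<^esup> v(E)\<close>. Let \<open>E\<^sub>n\<close> be the set where \<open>f / \<lambda>\<close> is of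
  size \<open>k\<^sup>n\<close>. Where \<open>S\<^sub>r f > \<lambda>\<close>, some \<open>E\<^sub>n\<close> has at least \<open>m \<approx> max 1 (k\<^bsup>r-n-\<epsilon>|n-r|\<^esup>)\<close> points in the sphere, and therefore
  \<open>u(S\<^sub>r f > \<lambda>) \<lesssim> \<Sum>\<^sub>n k\<^bsup>nq-\<delta>|n-r|\<^esup> v(E\<^sub>n)\<close>.
  Summing over \<open>r\<close> gives the weak type bound. If \<open>q < p\<close>, integrating over \<open>\<lambda>\<close> instead shows that the norm of
  \<open>S\<^sub>r : L\<^sup>p(v) \<rightarrow> L\<^sup>p(u)\<close> decays geometrically in \<open>r\<close>, which gives the strong bound; as \<open>S\<^sub>r\<close> is symmetric,
  the dual norms decay as well.
\<close>

section \<open>Spheres and balls in the tree\<close>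

lemma Cons_in_ktree [simp]: "i # x \<in> ktree k \<longleftrightarrow> i < k \<and> x \<in> ktree k"
  by (simp add: ktree_def)

lemma tree_path_rev: "tree_path k x p y \<Longrightarrow> tree_path k y (rev p) x"
  by (auto simp: tree_path_def hd_rev last_rev successively_rev tree_adj_def elim!: successively_mono)

lemma tree_dist_commute:
  assumes "x \<in> ktree k" "y \<in> ktree k"
  shows "tree_dist k x y = tree_dist k y x"
proof -
  obtain p where p: "tree_path k x p y"
    using tree_path_exists assms by blast
  show ?thesis
    using tree_dist_eq[OF p] tree_dist_eq[OF tree_path_rev[OF p]] by simp
qed

text \<open>Each edge adds or removes a front letter. A removal cancels the latest letter of
  \<open>zs\<close> if there is one, and otherwise climbs one more level above the start, raising
  \<open>i\<close>; so the number of edges bounds \<open>i + length zs\<close>.\<close>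

lemma walk_end:
  assumes "successively tree_adj p" "p \<noteq> []"
  shows "\<exists>i zs. last p = zs @ drop i (hd p) \<and> i + length zs \<le> length p - 1"
  using assms
proof (induction p rule: rev_induct)
  case (snoc y p)
  show ?case
  proof (cases "p = []")
    case True
    then show ?thesis by (intro exI[of _ 0] exI[of _ "[]"]) simp
  next
    case False
    from snoc.prems False have "successively tree_adj p" "tree_adj (last p) y"
      by (auto simp: successively_append_iff)
    with snoc.IH False obtain i zs
      where i: "last p = zs @ drop i (hd p)" "i + length zs \<le> length p - 1" by blast
    from False have l: "length p \<ge> 1" by (cases p) auto
    consider (down) j where "y = j # last p" | (up) j where "last p = j # y"
      using \<open>tree_adj (last p) y\<close> by (auto simp: tree_adj_def)
    then show ?thesis
    proof cases
      case down
      with i l False show ?thesis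
        by (intro exI[of _ i] exI[of _ "j # zs"]) simp
    next
      case up
      show ?thesis
      proof (cases zs)
        case Nil
        with up i(1) have "y = tl (drop i (hd p))" by (metis append_Nil list.sel(3))
        then have "y = drop (Suc i) (hd p)" by (simp add: drop_Suc drop_tl)
        with Nil i l False show ?thesis
          by (intro exI[of _ "Suc i"] exI[of _ "[]"]) simp
      next
        case (Cons c cs)
        with up i have "y = cs @ drop i (hd p)" by simp
        with Cons i l False show ?thesis
          by (intro exI[of _ i] exI[of _ cs]) simp
      qed
    qed
  qed
qed simp

text \<open>A point within distance \<open>r\<close> is reached by \<open>i\<close> steps up and at
  most \<open>r - i\<close> steps down. The cover serves for finiteness and for an upper count, so
  overlaps between different \<open>i\<close> do no harm.\<close>

lemma tree_ball_subset:
  assumes "x \<in> ktree k"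
  shows "tree_ball k x r \<subseteq> (\<Union>i\<le>r. (\<lambda>zs. zs @ drop i x) ` {zs. set zs \<subseteq> {..<k} \<and> length zs \<le> r - i})"
proof
  fix y assume "y \<in> tree_ball k x r"
  then have y: "y \<in> ktree k" "tree_dist k x y \<le> r" by (auto simp: tree_ball_def)
  obtain p where p: "tree_path k x p y"
    using tree_path_exists assms y by blast
  then have "length p - 1 \<le> r" using tree_dist_eq y by metis
  moreover from p obtain i zs where i: "y = zs @ drop i x" "i + length zs \<le> length p - 1"
    using walk_end[of p] by (auto simp: tree_path_def)
  moreover have "set zs \<subseteq> {..<k}" using y i by (auto simp: ktree_def)
  ultimately show "y \<in> (\<Union>i\<le>r. (\<lambda>zs. zs @ drop i x) ` {zs. set zs \<subseteq> {..<k} \<and> length zs \<le> r - i})"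
    by (intro UN_I[of i]) auto
qed

lemma sum_power_le:
  assumes "2 \<le> (k::nat)"
  shows "(\<Sum>i\<le>n. k ^ i) \<le> 2 * k ^ n"
proof (induction n)
  case (Suc n)
  have "2 * k ^ n \<le> k ^ Suc n" using assms by (simp only: power_Suc mult_le_mono1)
  moreover have "(\<Sum>i\<le>Suc n. k ^ i) = (\<Sum>i\<le>n. k ^ i) + k ^ Suc n" by simp
  ultimately show ?case using Suc by linarith
qed simp

lemma finite_tree_ball: "x \<in> ktree k \<Longrightarrow> finite (tree_ball k x r)"
  by (rule finite_subset[OF tree_ball_subset]) (auto simp: finite_lists_length_le)

text \<open>With \<open>i\<close> steps up there are at most \<open>2 * k ^ (r - i)\<close>
  endpoints, and summing over \<open>i\<close> costs another factor 2.\<close>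

lemma card_tree_ball_le:
  assumes "2 \<le> k" "x \<in> ktree k"
  shows "card (tree_ball k x r) \<le> 4 * k ^ r"
proof -
  let ?L = "\<lambda>i. {zs. set zs \<subseteq> {..<k} \<and> length zs \<le> r - i}"
  have fin: "finite (?L i)" for i by (simp add: finite_lists_length_le)
  have "card (tree_ball k x r) \<le> card (\<Union>i\<le>r. (\<lambda>zs. zs @ drop i x) ` ?L i)"
    using fin by (intro card_mono tree_ball_subset assms) auto
  also have "\<dots> \<le> (\<Sum>i\<le>r. card ((\<lambda>zs. zs @ drop i x) ` ?L i))"
    by (rule card_UN_le) simp
  also have "\<dots> \<le> (\<Sum>i\<le>r. card (?L i))"
    by (intro sum_mono card_image_le fin)
  also have "\<dots> = (\<Sum>i\<le>r. \<Sum>j\<le>r - i. k ^ j)"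
    by (simp add: card_lists_length_le)
  also have "\<dots> \<le> (\<Sum>i\<le>r. 2 * k ^ (r - i))"
    by (intro sum_mono sum_power_le assms)
  also have "\<dots> = 2 * (\<Sum>i\<le>r. k ^ i)"
    by (subst sum_distrib_left, rule sum.reindex_bij_witness[of _ "\<lambda>i. r - i" "\<lambda>i. r - i"]) auto
  also have "\<dots> \<le> 4 * k ^ r"
    using sum_power_le[OF assms(1), of r] by simp
  finally show ?thesis .
qed

lemma tree_dist_append:
  assumes "zs @ x \<in> ktree k"
  shows "tree_dist k (zs @ x) x = length zs"
proof -
  \<comment> \<open>The path strips the letters of \<open>zs\<close> one by one. The bound on the
    lengths of its vertices carries the induction: a newly prepended vertex is longer than all the
    others, so the path stays distinct.\<close>
  have "\<exists>p. tree_path k (zs @ x) p x \<and> length p = Suc (length zs)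
      \<and> (\<forall>y\<in>set p. length y \<le> length (zs @ x))"
    using assms
  proof (induction zs)
    case Nil
    then show ?case
      by (intro exI[of _ "[x]"]) (auto simp: tree_path_def)
  next
    case (Cons i zs)
    then obtain p where "tree_path k (zs @ x) p x" "length p = Suc (length zs)"
      "\<forall>y\<in>set p. length y \<le> length (zs @ x)" by auto
    with Cons.prems show ?case
      by (intro exI[of _ "(i # zs @ x) # p"])
        (force simp: tree_path_def successively_Cons tree_adj_def)
  qed
  then show ?thesis using tree_dist_eq by fastforce
qed

text \<open>The descendants of \<open>x\<close> exactly \<open>r\<close> generations below it
  already provide \<open>k ^ r\<close> points.\<close>

lemma card_tree_ball_ge:
  assumes "x \<in> ktree k"
  shows "k ^ r \<le> card (tree_ball k x r)"
proof -
  let ?L = "{zs. set zs \<subseteq> {..<k} \<and> length zs = r}"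
  have "(\<lambda>zs. zs @ x) ` ?L \<subseteq> tree_ball k x r"
  proof (clarsimp simp: tree_ball_def)
    fix zs assume "set zs \<subseteq> {..<k}" "r = length zs"
    then have "zs @ x \<in> ktree k" using assms by (auto simp: ktree_def)
    with assms show "zs @ x \<in> ktree k \<and> tree_dist k x (zs @ x) \<le> length zs"
      using tree_dist_append[of zs x k] tree_dist_commute[of x k "zs @ x"] by simp
  qed
  then have "card ((\<lambda>zs. zs @ x) ` ?L) \<le> card (tree_ball k x r)"
    by (rule card_mono[OF finite_tree_ball[OF assms]])
  moreover have "card ((\<lambda>zs. zs @ x) ` ?L) = k ^ r"
    by (subst card_image) (auto simp: inj_on_def card_lists_length_eq)
  ultimately show ?thesis by simp
qed

section \<open>Spherical means\<close>

definition tree_sphere :: "nat \<Rightarrow> nat list \<Rightarrow> nat \<Rightarrow> nat list set" where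
  "tree_sphere k x r = {y \<in> ktree k. tree_dist k x y = r}"

text \<open>Dividing by \<open>k ^ r\<close> instead of the size of the sphere gives a kernel that
  depends on the distance alone, hence a symmetric operator.\<close>

definition sphere_mean :: "nat \<Rightarrow> nat \<Rightarrow> (nat list \<Rightarrow> real) \<Rightarrow> nat list \<Rightarrow> real" where
  "sphere_mean k r g x = (\<Sum>y\<in>tree_sphere k x r. g y) / real k ^ r"

lemma sphere_mean_nonneg: "(\<And>x. 0 \<le> g x) \<Longrightarrow> 0 \<le> sphere_mean k r g x"
  by (simp add: sphere_mean_def sum_nonneg)

lemma tree_sphere_subset_ball: "tree_sphere k x r \<subseteq> tree_ball k x r"
  by (auto simp: tree_sphere_def tree_ball_def)

lemma finite_tree_sphere: "x \<in> ktree k \<Longrightarrow> finite (tree_sphere k x r)"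
  by (rule finite_subset[OF tree_sphere_subset_ball finite_tree_ball])

lemma card_tree_sphere_le: "2 \<le> k \<Longrightarrow> x \<in> ktree k \<Longrightarrow> card (tree_sphere k x r) \<le> 4 * k ^ r"
  using card_mono[OF finite_tree_ball tree_sphere_subset_ball] card_tree_ball_le le_trans by metis

text \<open>The ball is the disjoint union of its spheres, so the sum over it combines the spherical
  means with coefficients \<open>k ^ i\<close>. These add up to at most \<open>2 * k ^ r\<close>,
  while the ball has at least \<open>k ^ r\<close> points, so twice the largest mean
  dominates.\<close>

lemma ball_mean_le_sphere_mean:
  assumes k: "2 \<le> k" and x: "x \<in> ktree k" and g: "\<And>x. 0 \<le> g x"
  shows "\<exists>j\<le>r. (\<Sum>y\<in>tree_ball k x r. g y) / real (card (tree_ball k x r)) \<le> 2 * sphere_mean k j g x"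
proof -
  define m where "m = Max ((\<lambda>j. sphere_mean k j g x) ` {..r})"
  have "m \<in> (\<lambda>j. sphere_mean k j g x) ` {..r}"
    unfolding m_def by (rule Max_in) auto
  then obtain j where j: "j \<le> r" "m = sphere_mean k j g x" by auto
  have m: "sphere_mean k i g x \<le> m" if "i \<le> r" for i
    using that by (auto simp: m_def)
  have m0: "0 \<le> m" using j sphere_mean_nonneg g by metis
  have ball: "tree_ball k x r = (\<Union>i\<le>r. tree_sphere k x i)"
    by (auto simp: tree_ball_def tree_sphere_def)
  have "(\<Sum>y\<in>tree_ball k x r. g y) = (\<Sum>i\<le>r. \<Sum>y\<in>tree_sphere k x i. g y)"
    unfolding ball
    by (rule sum.UNION_disjoint) (auto simp: finite_tree_sphere x, auto simp: tree_sphere_def)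
  also have "\<dots> = (\<Sum>i\<le>r. real k ^ i * sphere_mean k i g x)"
    using k by (simp add: sphere_mean_def)
  also have "\<dots> \<le> (\<Sum>i\<le>r. real k ^ i * m)"
    by (intro sum_mono mult_left_mono m) auto
  also have "\<dots> = real (\<Sum>i\<le>r. k ^ i) * m"
    by (simp add: sum_distrib_right)
  also have "\<dots> \<le> real (2 * k ^ r) * m"
    by (intro mult_right_mono of_nat_mono sum_power_le k m0)
  also have "\<dots> \<le> 2 * m * real (card (tree_ball k x r))"
    using card_tree_ball_ge[OF x, of r] m0 
    by (simp add: mult.commute mult_left_mono flip: of_nat_power)
  finally have "(\<Sum>y\<in>tree_ball k x r. g y) \<le> 2 * m * real (card (tree_ball k x r))" .
  moreover have "0 < k ^ r" using k by simp
  with card_tree_ball_ge[OF x, of r] have "0 < card (tree_ball k x r)" by linarith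
  ultimately show ?thesis using j by (auto simp: pos_divide_le_eq)
qed

text \<open>Double counting of the pairs at distance \<open>r\<close>. Since \<open>B\<close>
  contains the spheres around points of \<open>A\<close> and \<open>\<phi>\<close> vanishes off
  \<open>A\<close>, the restriction to finite sets truncates neither mean.\<close>

lemma sum_sphere_mean_symmetric:
  assumes fin: "finite A" "finite B" and AB: "A \<subseteq> ktree k" "B \<subseteq> ktree k"
    and B: "\<And>x. x \<in> A \<Longrightarrow> tree_sphere k x r \<subseteq> B"
    and supp: "\<And>x. x \<notin> A \<Longrightarrow> \<phi> x = 0"
  shows "(\<Sum>x\<in>A. \<phi> x * sphere_mean k r g x) = (\<Sum>y\<in>B. g y * sphere_mean k r \<phi> y)"
proof -
  have "(\<Sum>x\<in>A. \<phi> x * sphere_mean k r g x)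
      = (\<Sum>x\<in>A. \<Sum>y\<in>B. if tree_dist k x y = r then \<phi> x * g y / real k ^ r else 0)"
  proof (rule sum.cong[OF refl])
    fix x assume x: "x \<in> A"
    have "{y \<in> B. tree_dist k x y = r} = tree_sphere k x r"
      using B[OF x] AB by (auto simp: tree_sphere_def)
    then show "\<phi> x * sphere_mean k r g x
        = (\<Sum>y\<in>B. if tree_dist k x y = r then \<phi> x * g y / real k ^ r else 0)"
      by (simp add: sphere_mean_def sum_distrib_left sum_divide_distrib
          flip: sum.inter_filter[OF fin(2)])
  qed
  also have "\<dots> = (\<Sum>y\<in>B. \<Sum>x\<in>A. if tree_dist k x y = r then \<phi> x * g y / real k ^ r else 0)"
    by (rule sum.swap)
  also have "\<dots> = (\<Sum>y\<in>B. g y * sphere_mean k r \<phi> y)"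
  proof (rule sum.cong[OF refl])
    fix y assume y: "y \<in> B"
    have comm: "tree_dist k y x = tree_dist k x y" if "x \<in> A" for x
      using tree_dist_commute that y AB by (metis subsetD)
    have supp_in: "x \<in> A" if "\<phi> x \<noteq> 0" for x using supp that by blast
    have "(\<Sum>x\<in>tree_sphere k y r. \<phi> x) = (\<Sum>x\<in>{x\<in>A. tree_dist k x y = r}. \<phi> x)"
      using y AB supp
      by (intro sum.mono_neutral_right finite_tree_sphere)
        (auto simp: tree_sphere_def comm dest: comm[OF supp_in])
    then show "(\<Sum>x\<in>A. if tree_dist k x y = r then \<phi> x * g y / real k ^ r else 0)
        = g y * sphere_mean k r \<phi> y"
      by (simp add: sphere_mean_def sum_distrib_left sum_divide_distrib mult.commute
          flip: sum.inter_filter[OF fin(1)])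
  qed
  finally show ?thesis .
qed

section \<open>Sums against a weight\<close>

lemma nn_integral_weight_measure:
  "(\<integral>\<^sup>+x. h x \<partial>weight_measure k w) = (\<integral>\<^sup>+x. ennreal (w x) * h x \<partial>count_space (ktree k))"
  unfolding weight_measure_def by (rule nn_integral_density) auto

lemma sets_weight_measure [simp]: "sets (weight_measure k w) = Pow (ktree k)"
  by (simp add: weight_measure_def)

lemma space_weight_measure [simp]: "space (weight_measure k w) = ktree k"
  by (simp add: weight_measure_def)

lemma measurable_weight_measure [simp]:
  "h \<in> measurable (weight_measure k w) M \<longleftrightarrow> h \<in> ktree k \<rightarrow> space M"
  by (simp add: weight_measure_def)

section \<open>Reduction to finite sets of vertices\<close>

lemma finite_ktree_length_le: "finite {x \<in> ktree k. length x \<le> n}"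
proof -
  have "{x \<in> ktree k. length x \<le> n} = {x. set x \<subseteq> {..<k} \<and> length x \<le> n}"
    by (auto simp: ktree_def)
  then show ?thesis by (simp add: finite_lists_length_le)
qed

text \<open>Monotone convergence along the words of length at most \<open>n\<close>, which are
  finite in number and exhaust the tree.\<close>

lemma nn_integral_weight_measure_le:
  assumes "\<And>F. finite F \<Longrightarrow> F \<subseteq> ktree k \<Longrightarrow> (\<Sum>x\<in>F. ennreal (w x) * h x) \<le> c"
  shows "(\<integral>\<^sup>+x. h x \<partial>weight_measure k w) \<le> c"
proof -
  define T where "T n = {x \<in> ktree k. length x \<le> n}" for n
  have lim: "(SUP n. h x * indicator (T n) x) = h x" if "x \<in> ktree k" for x
  proof (rule SUP_eqI)
    fix c assume "\<And>n. n \<in> UNIV \<Longrightarrow> h x * indicator (T n) x \<le> c"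
    from this[of "length x"] show "h x \<le> c" using that by (simp add: T_def)
  qed (auto simp: indicator_def)
  have "(\<integral>\<^sup>+x. h x \<partial>weight_measure k w) = (\<integral>\<^sup>+x. (SUP n. h x * indicator (T n) x) \<partial>weight_measure k w)"
    by (rule nn_integral_cong) (simp add: lim)
  also have "\<dots> = (SUP n. \<integral>\<^sup>+x. h x * indicator (T n) x \<partial>weight_measure k w)"
    by (rule nn_integral_monotone_convergence_SUP)
      (auto simp: incseq_def le_fun_def T_def indicator_def)
  also have "\<dots> \<le> c"
  proof (rule SUP_least)
    fix n
    have "(\<integral>\<^sup>+x. h x * indicator (T n) x \<partial>weight_measure k w) = (\<Sum>x\<in>T n. ennreal (w x) * (h x * indicator (T n) x))"
      unfolding nn_integral_weight_measure
      using finite_ktree_length_le by (intro nn_integral_count_space') (auto simp: T_def)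
    also have "\<dots> = (\<Sum>x\<in>T n. ennreal (w x) * h x)"
      by (intro sum.cong) auto
    also have "\<dots> \<le> c"
      using finite_ktree_length_le by (intro assms) (auto simp: T_def)
    finally show "(\<integral>\<^sup>+x. h x * indicator (T n) x \<partial>weight_measure k w) \<le> c" .
  qed
  finally show ?thesis .
qed

lemma emeasure_weight_measure_finite:
  assumes "is_weight k w" "finite F" "F \<subseteq> ktree k"
  shows "emeasure (weight_measure k w) F = ennreal (\<Sum>x\<in>F. w x)"
proof -
  have "emeasure (weight_measure k w) F = (\<integral>\<^sup>+x. indicator F x \<partial>weight_measure k w)"
    using assms by simp
  also have "\<dots> = (\<Sum>x\<in>F. ennreal (w x) * indicator F x)"
    unfolding nn_integral_weight_measure using assms
    by (intro nn_integral_count_space') auto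
  also have "\<dots> = (\<Sum>x\<in>F. ennreal (w x))"
    by (intro sum.cong) auto
  also have "\<dots> = ennreal (\<Sum>x\<in>F. w x)"
    using assms by (intro sum_ennreal) (auto simp: is_weight_def less_imp_le)
  finally show ?thesis .
qed

text \<open>Lets estimates known for finite sets, such as those drawn from the spherical condition,
  pass to arbitrary sets of vertices.\<close>

lemma emeasure_weight_measure_le:
  assumes "is_weight k w" "A \<subseteq> ktree k"
    and "\<And>F. finite F \<Longrightarrow> F \<subseteq> A \<Longrightarrow> ennreal (\<Sum>x\<in>F. w x) \<le> c"
  shows "emeasure (weight_measure k w) A \<le> c"
proof -
  have "emeasure (weight_measure k w) A = (\<integral>\<^sup>+x. indicator A x \<partial>weight_measure k w)"
    using assms by simp
  also have "\<dots> \<le> c"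
  proof (rule nn_integral_weight_measure_le)
    fix F assume F: "finite F" "F \<subseteq> ktree k"
    have "(\<Sum>x\<in>F. ennreal (w x) * indicator A x) = (\<Sum>x\<in>F \<inter> A. ennreal (w x))"
      using F by (intro sum.mono_neutral_cong_right) auto
    also have "\<dots> = ennreal (\<Sum>x\<in>F \<inter> A. w x)"
      using assms F by (intro sum_ennreal) (auto simp: is_weight_def less_imp_le)
    also have "\<dots> \<le> c" using F by (intro assms) auto
    finally show "(\<Sum>x\<in>F. ennreal (w x) * indicator A x) \<le> c" .
  qed
  finally show ?thesis .
qed

lemma sum_le_nn_integral_weight_measure:
  assumes "finite B" "B \<subseteq> ktree k"
  shows "(\<Sum>x\<in>B. ennreal (w x) * h x) \<le> (\<integral>\<^sup>+x. h x \<partial>weight_measure k w)"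
proof -
  have "(\<Sum>x\<in>B. ennreal (w x) * h x) = (\<Sum>x\<in>B. ennreal (w x) * (h x * indicator B x))"
    by (intro sum.cong) auto
  also have "\<dots> = (\<integral>\<^sup>+x. h x * indicator B x \<partial>weight_measure k w)"
    unfolding nn_integral_weight_measure using assms
    by (intro nn_integral_count_space'[symmetric]) auto
  also have "\<dots> \<le> (\<integral>\<^sup>+x. h x \<partial>weight_measure k w)"
    by (intro nn_integral_mono) (auto simp: indicator_def)
  finally show ?thesis .
qed

text \<open>The sum has at most one nonzero term. It is applied pointwise to sums of indicators of
  disjoint level sets.\<close>

lemma nn_integral_le_of_unique:
  fixes f :: "'a \<Rightarrow> ennreal"
  assumes "\<And>i j. f i \<noteq> 0 \<Longrightarrow> f j \<noteq> 0 \<Longrightarrow> i = j" and "\<And>i. f i \<le> B"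
  shows "(\<integral>\<^sup>+i. f i \<partial>count_space UNIV) \<le> B"
proof (cases "\<exists>i. f i \<noteq> 0")
  case True
  then obtain i where "f i \<noteq> 0" by blast
  with assms(1) have "(\<integral>\<^sup>+i. f i \<partial>count_space UNIV) = (\<Sum>j\<in>{i}. f j)"
    by (intro nn_integral_count_space') auto
  with assms(2)[of i] show ?thesis by simp
next
  case False
  then show ?thesis by simp
qed

section \<open>Level sets\<close>

text \<open>The terms left of \<open>r\<close> and those from \<open>r\<close> on are each dominated
  by a geometric series of ratio \<open>b powr (- \<epsilon>)\<close>, whence the factor 2.\<close>

lemma sum_powr_dist_le:
  fixes b \<epsilon> :: real
  assumes b: "1 < b" and \<epsilon>: "0 < \<epsilon>" and T: "finite T"
  shows "(\<Sum>n\<in>T. b powr (- \<epsilon> * \<bar>real n - real r\<bar>)) \<le> 2 / (1 - b powr (- \<epsilon>))"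
proof -
  define \<rho> where "\<rho> = b powr (- \<epsilon>)"
  have \<rho>: "0 < \<rho>" "\<rho> < 1"
    using b \<epsilon> by (auto simp: \<rho>_def powr_less_one)
  have pow: "b powr (- \<epsilon> * real i) = \<rho> ^ i" for i
    using b by (simp add: \<rho>_def powr_realpow[symmetric] powr_powr)
  have geo: "(\<Sum>i\<in>I. \<rho> ^ i) \<le> 1 / (1 - \<rho>)" if "finite I" for I
    using sum_le_suminf[OF summable_geometric, of \<rho> I] suminf_geometric[of \<rho>] \<rho> that by simp
  have split: "T = (T \<inter> {..<r}) \<union> (T \<inter> {r..})" by auto
  have "(\<Sum>n\<in>T. b powr (- \<epsilon> * \<bar>real n - real r\<bar>))
      = (\<Sum>n\<in>T \<inter> {..<r}. b powr (- \<epsilon> * \<bar>real n - real r\<bar>))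
        + (\<Sum>n\<in>T \<inter> {r..}. b powr (- \<epsilon> * \<bar>real n - real r\<bar>))"
    by (subst split, rule sum.union_disjoint) (auto simp: T)
  also have "(\<Sum>n\<in>T \<inter> {..<r}. b powr (- \<epsilon> * \<bar>real n - real r\<bar>)) = (\<Sum>n\<in>T \<inter> {..<r}. \<rho> ^ (r - n))"
    by (intro sum.cong refl) (auto simp: pow[symmetric] of_nat_diff)
  also have "\<dots> = (\<Sum>i\<in>(\<lambda>n. r - n) ` (T \<inter> {..<r}). \<rho> ^ i)"
    by (subst sum.reindex) (auto simp: inj_on_def)
  also have "\<dots> \<le> 1 / (1 - \<rho>)" by (rule geo) (simp add: T)
  also have "(\<Sum>n\<in>T \<inter> {r..}. b powr (- \<epsilon> * \<bar>real n - real r\<bar>)) = (\<Sum>n\<in>T \<inter> {r..}. \<rho> ^ (n - r))"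
    by (intro sum.cong refl) (auto simp: pow[symmetric] of_nat_diff)
  also have "\<dots> = (\<Sum>i\<in>(\<lambda>n. n - r) ` (T \<inter> {r..}). \<rho> ^ i)"
    by (subst sum.reindex) (auto simp: inj_on_def)
  also have "\<dots> \<le> 1 / (1 - \<rho>)" by (rule geo) (simp add: T)
  finally show ?thesis by (simp add: \<rho>_def)
qed

text \<open>
  At height \<open>\<lambda>\<close> only the values of \<open>g\<close> above \<open>\<lambda> / k\<^sup>3\<close> matter, because a sphere of radius \<open>r\<close> has
  at most \<open>4 k\<^sup>r\<close> points and \<open>4 < k\<^sup>3\<close>; level \<open>n\<close> collects those between \<open>\<lambda> k\<^bsup>n-3\<^esup>\<close> and \<open>\<lambda> k\<^bsup>n-2\<^esup>\<close>.
\<close>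

definition level_set :: "nat \<Rightarrow> (nat list \<Rightarrow> real) \<Rightarrow> real \<Rightarrow> nat \<Rightarrow> nat list set" where
  "level_set k g l n = {x \<in> ktree k. real k ^ n \<le> real k ^ 3 * g x / l \<and> real k ^ 3 * g x / l < real k ^ Suc n}"

lemma level_set_subset: "level_set k g l n \<subseteq> ktree k"
  by (auto simp: level_set_def)

lemma level_set_unique:
  assumes "2 \<le> k" "x \<in> level_set k g l n" "x \<in> level_set k g l m"
  shows "n = m"
proof -
  have "real k ^ n < real k ^ Suc m" "real k ^ m < real k ^ Suc n"
    using assms(2,3) unfolding level_set_def by (blast intro: le_less_trans)+
  moreover have "1 < real k" using assms by simp
  ultimately have "n < Suc m" "m < Suc n"
    using power_less_imp_less_exp by blast+
  then show ?thesis by simp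
qed

text \<open>Pigeonhole: if every level failed, the values on the sphere, scaled by
  \<open>k ^ 3 / l\<close>, would sum to at most \<open>4 * k ^ r + k ^ r / 2\<close>, whereas the
  assumption makes this sum exceed \<open>8 * k ^ r\<close>. For \<open>n > r\<close> the lower
  bound is below 1, and the information lies in the intersection being nonempty.\<close>

lemma exists_large_level_set:
  assumes k: "2 \<le> k" and y: "y \<in> ktree k" and g: "\<And>x. 0 \<le> g x" and l: "0 < l"
    and \<epsilon>: "0 < \<epsilon>" and large: "l < sphere_mean k r g y"
  shows "\<exists>n. 0 < card (level_set k g l n \<inter> tree_sphere k y r) \<and>
    (1 - real k powr (- \<epsilon>)) / 4 * real k powr (real r - real n - 1 - \<epsilon> * \<bar>real n - real r\<bar>)
      \<le> real (card (level_set k g l n \<inter> tree_sphere k y r))"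
proof (rule ccontr)
  define G where "G x = real k ^ 3 * g x / l" for x
  define S where "S = tree_sphere k y r"
  \<comment> \<open>The value of \<open>c\<close> cancels the constant of
    \<open>sum_powr_dist_le\<close> down to \<open>1 / 2\<close>.\<close>
  define c where "c = (1 - real k powr (- \<epsilon>)) / 4"
  define m where "m n = c * real k powr (real r - real n - 1 - \<epsilon> * \<bar>real n - real r\<bar>)" for n
  assume "\<not> ?thesis"
  then have none: "card (level_set k g l n \<inter> S) = 0 \<or> real (card (level_set k g l n \<inter> S)) < m n" for n
    by (auto simp: S_def m_def c_def not_le)
  have k1: "1 < real k" "0 < real k" using k by auto
  then have c: "0 < c" using \<epsilon> by (simp add: c_def powr_less_one)
  have few: "real (card (level_set k g l n \<inter> S)) \<le> m n" for n
    using none[of n] c by (auto simp: m_def)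
  have finS: "finite S" and cardS: "card S \<le> 4 * k ^ r"
    using finite_tree_sphere card_tree_sphere_le k y by (auto simp: S_def)
  have "S \<subseteq> ktree k" by (auto simp: S_def tree_sphere_def)
  have k3: "8 \<le> real k ^ 3"
    using power_mono[of 2 "real k" 3] k by simp
  have G0: "0 \<le> G x" for x using g l by (simp add: G_def)
  have "8 * real k ^ r \<le> real k ^ 3 * real k ^ r"
    using k3 by (intro mult_right_mono) auto
  also have "\<dots> < real k ^ 3 * ((\<Sum>x\<in>S. g x) / l)"
  proof -
    have "real k ^ r < (\<Sum>x\<in>S. g x) / l"
      using large l k1 by (simp add: sphere_mean_def S_def field_simps)
    then show ?thesis using k1 by (intro mult_strict_left_mono) auto
  qed
  also have "\<dots> = (\<Sum>x\<in>S. G x)"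
    by (simp add: G_def sum_distrib_left sum_divide_distrib)
  also have "\<dots> = (\<Sum>x\<in>{x\<in>S. G x < 1}. G x) + (\<Sum>x\<in>{x\<in>S. 1 \<le> G x}. G x)"
    by (subst sum.union_disjoint[symmetric]) (auto simp: finS intro!: sum.cong)
  also have "(\<Sum>x\<in>{x\<in>S. G x < 1}. G x) \<le> 4 * real k ^ r"
  proof -
    have "(\<Sum>x\<in>{x\<in>S. G x < 1}. G x) \<le> real (card {x\<in>S. G x < 1}) * 1"
      by (rule sum_bounded_above) auto
    also have "\<dots> \<le> real (card S)" using finS by (auto intro!: card_mono)
    also have "\<dots> \<le> real (4 * k ^ r)" using cardS of_nat_mono by blast
    finally show ?thesis by simp
  qed
  \<comment> \<open>Group by the level \<open>\<nu> x\<close>: level \<open>n\<close> holds at most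
    \<open>m n\<close> points with values below \<open>k ^ Suc n\<close>. The \<open>- 1\<close> in
    the exponent of \<open>m n\<close> offsets the \<open>Suc\<close>, which leaves
    \<open>c * k ^ r\<close> times a factor decaying away from \<open>n = r\<close>.\<close>
  also have "(\<Sum>x\<in>{x\<in>S. 1 \<le> G x}. G x) \<le> real k ^ r / 2"
  proof -
    define \<nu> where "\<nu> x = nat \<lfloor>log (real k) (G x)\<rfloor>" for x
    have \<nu>: "real k ^ \<nu> x \<le> G x \<and> G x < real k ^ Suc (\<nu> x)" if "1 \<le> G x" for x
    proof -
      have l0: "0 \<le> log (real k) (G x)" using that k1 by simp
      then have "real (\<nu> x) \<le> log (real k) (G x)" "log (real k) (G x) < real (Suc (\<nu> x))"
        unfolding \<nu>_def by linarith+
      with that k1 have "real k powr real (\<nu> x) \<le> G x" "G x < real k powr real (Suc (\<nu> x))"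
        by (simp_all add: le_log_iff log_less_iff del: of_nat_Suc)
      with k1 show ?thesis by (simp only: powr_realpow)
    qed
    let ?A = "{x\<in>S. 1 \<le> G x}"
    have "(\<Sum>x\<in>?A. G x) = (\<Sum>n\<in>\<nu> ` ?A. \<Sum>x\<in>{x\<in>?A. \<nu> x = n}. G x)"
      using finS by (intro sum.group[symmetric]) auto
    also have "\<dots> \<le> (\<Sum>n\<in>\<nu> ` ?A. real k ^ Suc n * m n)"
    proof (rule sum_mono)
      fix n
      have "{x\<in>?A. \<nu> x = n} \<subseteq> level_set k g l n \<inter> S"
        using \<nu> \<open>S \<subseteq> ktree k\<close> by (auto simp: level_set_def G_def)
      then have "card {x\<in>?A. \<nu> x = n} \<le> card (level_set k g l n \<inter> S)"
        using finS by (intro card_mono) auto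
      with few[of n] have card: "real (card {x\<in>?A. \<nu> x = n}) \<le> m n" by linarith
      have "(\<Sum>x\<in>{x\<in>?A. \<nu> x = n}. G x) \<le> real (card {x\<in>?A. \<nu> x = n}) * real k ^ Suc n"
        using \<nu> by (intro sum_bounded_above) (auto simp: less_imp_le)
      also have "\<dots> \<le> m n * real k ^ Suc n"
        using card by (intro mult_right_mono) auto
      finally show "(\<Sum>x\<in>{x\<in>?A. \<nu> x = n}. G x) \<le> real k ^ Suc n * m n" by (simp add: mult.commute)
    qed
    also have "\<dots> = (\<Sum>n\<in>\<nu> ` ?A. c * real k ^ r * real k powr (- \<epsilon> * \<bar>real n - real r\<bar>))"
    proof (rule sum.cong[OF refl])
      fix n
      have "real k ^ Suc n * m n = c * (real k powr real (Suc n) * real k powr (real r - real n - 1 - \<epsilon> * \<bar>real n - real r\<bar>))"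
        using k1 by (simp add: m_def powr_realpow del: of_nat_Suc power_Suc)
      also have "\<dots> = c * (real k powr real r * real k powr (- \<epsilon> * \<bar>real n - real r\<bar>))"
        by (simp add: powr_add[symmetric])
      finally show "real k ^ Suc n * m n = c * real k ^ r * real k powr (- \<epsilon> * \<bar>real n - real r\<bar>)"
        using k1 by (simp add: powr_realpow)
    qed
    also have "\<dots> = c * real k ^ r * (\<Sum>n\<in>\<nu> ` ?A. real k powr (- \<epsilon> * \<bar>real n - real r\<bar>))"
      by (simp add: sum_distrib_left)
    also have "\<dots> \<le> c * real k ^ r * (2 / (1 - real k powr (- \<epsilon>)))"
      using c finS k1 \<epsilon> by (intro mult_left_mono sum_powr_dist_le) auto
    also have "\<dots> = real k ^ r / 2"
      using c by (simp add: c_def field_simps)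
    finally show ?thesis .
  qed
  finally have "8 * real k ^ r < 4 * real k ^ r + real k ^ r / 2" by simp
  moreover have "0 < real k ^ r" using k1 by simp
  ultimately show False by linarith
qed

text \<open>The values of \<open>g\<close> in level \<open>n\<close> at height
  \<open>k powr i\<close> fill a half-open interval, and these intervals are adjacent for successive
  \<open>i\<close>. Used with \<open>i\<close> and \<open>j\<close> exchanged as well, this gives
  \<open>i = j\<close>.\<close>

lemma level_set_scale_less:
  fixes i j :: int
  assumes k: "2 \<le> k" and x: "x \<in> level_set k g (real k powr real_of_int i) n"
    "x \<in> level_set k g (real k powr real_of_int j) n"
  shows "i < j + 1"
proof -
  have k1: "1 < real k" using k by simp
  have "real k ^ n * real k powr real_of_int i \<le> real k ^ 3 * g x"
    using x(1) k1 by (simp add: level_set_def field_simps)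
  also have "real k ^ 3 * g x < real k ^ Suc n * real k powr real_of_int j"
    using x(2) k1 by (simp add: level_set_def field_simps)
  finally have "real k powr (real n + real_of_int i) < real k powr (real (Suc n) + real_of_int j)"
    using k1 by (simp only: powr_add powr_realpow)
  then show ?thesis using k1 by simp
qed

section \<open>Bounds for the spherical means\<close>

locale spherical_condition =
  fixes k :: nat and p \<alpha> \<beta> C :: real and u v :: "nat list \<Rightarrow> real"
  assumes k: "2 \<le> k" and p: "1 < p" and u: "is_weight k u" and v: "is_weight k v"
    and \<beta>: "0 < \<beta>" "\<beta> < 1" and \<alpha>: "\<beta> \<le> \<alpha>" "\<alpha> < p" and C: "0 < C"
    and spherical: "\<And>E F r. finite E \<Longrightarrow> E \<subseteq> ktree k \<Longrightarrow> finite F \<Longrightarrow> F \<subseteq> ktree k \<Longrightarrow>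
      (\<Sum>x\<in>E. \<Sum>y\<in>{y\<in>F. tree_dist k x y = r}. u y)
        \<le> C * real k powr (real r * \<beta>) * (\<Sum>x\<in>E. v x) powr (\<alpha> / p) * (\<Sum>x\<in>F. u x) powr (1 - \<alpha> / p)"
begin

abbreviation "q \<equiv> \<beta> / \<alpha> * p"

lemma \<alpha>_pos: "0 < \<alpha>" using \<beta> \<alpha> by simp

lemma q_pos: "0 < q" using \<beta> \<alpha>_pos p by simp

lemma k_gt_1: "1 < real k" using k by simp

text \<open>Counting pairs at distance \<open>r\<close> bounds \<open>m * U\<close> by the left side
  of the spherical condition. Dividing by the power \<open>1 - \<alpha> / p\<close> of
  \<open>U\<close> and raising to the power \<open>p / \<alpha>\<close> isolates \<open>U\<close>
  and makes the right side linear in \<open>V\<close>.\<close>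

lemma sum_weight_le_of_card:
  assumes E: "finite E" "E \<subseteq> ktree k" and F: "finite F" "F \<subseteq> ktree k" and m: "0 < m"
    and many: "\<And>y. y \<in> F \<Longrightarrow> m \<le> real (card (E \<inter> tree_sphere k y r))"
  shows "(\<Sum>y\<in>F. u y) \<le> (C * real k powr (real r * \<beta>) / m) powr (p / \<alpha>) * (\<Sum>x\<in>E. v x)"
proof -
  define U where "U = (\<Sum>y\<in>F. u y)"
  define V where "V = (\<Sum>x\<in>E. v x)"
  define B where "B = C * real k powr (real r * \<beta>)"
  have u0: "0 \<le> u y" if "y \<in> F" for y using that F u by (auto simp: is_weight_def less_imp_le)
  have UV: "0 \<le> U" "0 \<le> V"
    using E F u v by (auto simp: U_def V_def is_weight_def less_imp_le intro!: sum_nonneg)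
  have B: "0 < B" using C k by (simp add: B_def)
  show ?thesis
  proof (cases "U = 0")
    case True
    with UV show ?thesis by (simp add: U_def V_def)
  next
    case False
    with UV have U: "0 < U" by simp
    have "m * U = (\<Sum>y\<in>F. m * u y)" by (simp add: U_def sum_distrib_left)
    also have "\<dots> \<le> (\<Sum>y\<in>F. real (card (E \<inter> tree_sphere k y r)) * u y)"
      by (intro sum_mono mult_right_mono many u0)
    also have "\<dots> = (\<Sum>y\<in>F. \<Sum>x\<in>E. if tree_dist k x y = r then u y else 0)"
    proof (rule sum.cong[OF refl])
      fix y assume "y \<in> F"
      then have "E \<inter> tree_sphere k y r = {x\<in>E. tree_dist k x y = r}"
        using tree_dist_commute E F by (auto simp: tree_sphere_def subset_iff)
      then show "real (card (E \<inter> tree_sphere k y r)) * u y = (\<Sum>x\<in>E. if tree_dist k x y = r then u y else 0)"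
        by (simp flip: sum.inter_filter[OF E(1)])
    qed
    also have "\<dots> = (\<Sum>x\<in>E. \<Sum>y\<in>{y\<in>F. tree_dist k x y = r}. u y)"
      by (subst sum.swap) (simp add: sum.inter_filter[OF F(1)] cong: sum.cong)
    also have "\<dots> \<le> B * V powr (\<alpha> / p) * U powr (1 - \<alpha> / p)"
      unfolding B_def U_def V_def by (rule spherical[OF E F])
    also have "\<dots> = B * V powr (\<alpha> / p) * U / U powr (\<alpha> / p)"
      using U by (simp add: powr_diff)
    finally have "m * U powr (\<alpha> / p) \<le> B * V powr (\<alpha> / p)"
      using U by (simp add: field_simps)
    then have "U powr (\<alpha> / p) \<le> B / m * V powr (\<alpha> / p)"
      using m by (simp add: field_simps)
    then have "(U powr (\<alpha> / p)) powr (p / \<alpha>) \<le> (B / m * V powr (\<alpha> / p)) powr (p / \<alpha>)"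
      using \<alpha>_pos p by (intro powr_mono2) auto
    also have "\<dots> = (B / m) powr (p / \<alpha>) * (V powr (\<alpha> / p)) powr (p / \<alpha>)"
      by (rule powr_mult)
    finally show ?thesis
      using UV \<alpha>_pos p by (simp add: powr_powr U_def V_def B_def)
  qed
qed

text \<open>For a finite part \<open>F0\<close> of \<open>F\<close>, only the points of
  \<open>E\<close> on the spheres around \<open>F0\<close> matter. They form a finite set
  \<open>E0\<close>, and a point of \<open>F0\<close> sees as many points of \<open>E0\<close> as of
  \<open>E\<close>.\<close>

lemma emeasure_le_of_card:
  assumes E: "E \<subseteq> ktree k" and F: "F \<subseteq> ktree k" and m: "0 < m"
    and many: "\<And>y. y \<in> F \<Longrightarrow> m \<le> real (card (E \<inter> tree_sphere k y r))"
  shows "emeasure (weight_measure k u) F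
    \<le> ennreal ((C * real k powr (real r * \<beta>) / m) powr (p / \<alpha>)) * emeasure (weight_measure k v) E"
proof (rule emeasure_weight_measure_le[OF u F])
  fix F0 assume F0: "finite F0" "F0 \<subseteq> F"
  define E0 where "E0 = (\<Union>y\<in>F0. E \<inter> tree_sphere k y r)"
  have fin: "finite E0"
    unfolding E0_def using F0 F by (intro finite_UN_I finite_Int disjI2 finite_tree_sphere) auto
  have sub: "E0 \<subseteq> E" by (auto simp: E0_def)
  have "(\<Sum>y\<in>F0. u y) \<le> (C * real k powr (real r * \<beta>) / m) powr (p / \<alpha>) * (\<Sum>x\<in>E0. v x)"
  proof (rule sum_weight_le_of_card)
    fix y assume y: "y \<in> F0"
    then have "E0 \<inter> tree_sphere k y r = E \<inter> tree_sphere k y r"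
      by (auto simp: E0_def)
    then show "m \<le> real (card (E0 \<inter> tree_sphere k y r))" using many y F0 by auto
  qed (use fin sub E F F0 m in auto)
  then have "ennreal (\<Sum>y\<in>F0. u y)
      \<le> ennreal ((C * real k powr (real r * \<beta>) / m) powr (p / \<alpha>)) * emeasure (weight_measure k v) E0"
    using fin sub E v
    by (subst emeasure_weight_measure_finite) (auto simp: ennreal_mult'[symmetric] intro!: ennreal_leI)
  also have "\<dots> \<le> ennreal ((C * real k powr (real r * \<beta>) / m) powr (p / \<alpha>)) * emeasure (weight_measure k v) E"
    using sub E by (intro mult_left_mono emeasure_mono) auto
  finally show "ennreal (\<Sum>x\<in>F0. u x) \<le> \<dots>" .
qed

section \<open>Distribution function of the spherical means\<close>

text \<open>By pigeonhole, each point where the mean exceeds \<open>l\<close> lies in some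
  \<open>F n\<close>, the set of points that see at least \<open>m n\<close> points of level
  \<open>n\<close>; each \<open>F n\<close> is measured by \<open>emeasure_le_of_card\<close>. The
  decay in \<open>|n - r|\<close> is what later makes the sum over \<open>r\<close>
  converge.\<close>

lemma emeasure_sphere_mean_gt:
  obtains K \<delta> where "0 < K" "0 < \<delta>"
    "\<And>g l r. (\<And>x. 0 \<le> g x) \<Longrightarrow> 0 < l \<Longrightarrow>
      emeasure (weight_measure k u) {y \<in> ktree k. l < sphere_mean k r g y}
        \<le> (\<Sum>n. ennreal (K * real k powr (real n * q - \<delta> * \<bar>real n - real r\<bar>)) *
              emeasure (weight_measure k v) (level_set k g l n))"
proof -
  \<comment> \<open>The pigeonhole count loses \<open>\<epsilon> * |n - r|\<close> in the exponent.
    Spending half of \<open>1 - \<beta>\<close> on it leaves the other half as a gain.\<close>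
  define \<epsilon> where "\<epsilon> = (1 - \<beta>) / 2"
  define \<eta> where "\<eta> = min \<beta> \<epsilon>"
  define c where "c = (1 - real k powr (- \<epsilon>)) / 4"
  define K where "K = (C * real k / c) powr (p / \<alpha>)"
  define \<delta> where "\<delta> = \<eta> * (p / \<alpha>)"
  have \<epsilon>: "0 < \<epsilon>" using \<beta> by (simp add: \<epsilon>_def)
  have \<eta>: "0 < \<eta>" "\<eta> \<le> \<beta>" "\<eta> \<le> \<epsilon>" using \<beta> \<epsilon> by (auto simp: \<eta>_def)
  have c: "0 < c" using \<epsilon> k_gt_1 by (simp add: c_def powr_less_one)
  have "c \<le> (1 - 0) / 4"
    unfolding c_def by (intro divide_right_mono diff_left_mono powr_ge_zero) simp
  then have c1: "c \<le> 1" by simp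
  show thesis
  proof
    show "0 < K" using C c k by (simp add: K_def)
    show "0 < \<delta>" using \<eta> \<alpha>_pos p by (simp add: \<delta>_def)
    fix g :: "nat list \<Rightarrow> real" and l :: real and r :: nat
    assume g: "\<And>x. 0 \<le> g x" and l: "0 < l"
    \<comment> \<open>For \<open>n > r\<close> the pigeonhole bound is below 1, so the existence of
      one point is the better count.\<close>
    define m where "m n = (if n \<le> r then c * real k powr (real r - real n - 1 - \<epsilon> * \<bar>real n - real r\<bar>) else 1)"
      for n :: nat
    define F where "F n = {y \<in> ktree k. m n \<le> real (card (level_set k g l n \<inter> tree_sphere k y r))}" for n
    have m: "0 < m n" for n using c k by (simp add: m_def)
    \<comment> \<open>Relative to \<open>n * \<beta>\<close> the exponent gains
      \<open>\<epsilon> * (r - n)\<close> if \<open>n \<le> r\<close>, and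
      \<open>\<beta> * (n - r)\<close> otherwise; \<open>\<eta>\<close> is the smaller rate. The
      factor \<open>k / c\<close> covers the constants in \<open>m n\<close>.\<close>
    have ratio: "C * real k powr (real r * \<beta>) / m n
        \<le> C * real k / c * real k powr (real n * \<beta> - \<eta> * \<bar>real n - real r\<bar>)" for n
    proof (cases "n \<le> r")
      case True
      have "\<eta> * (real r - real n) \<le> \<epsilon> * (real r - real n)"
        using True \<eta> by (intro mult_right_mono) auto
      then have "real r * \<beta> - (real r - real n - 1 - \<epsilon> * \<bar>real n - real r\<bar>)
          \<le> 1 + (real n * \<beta> - \<eta> * \<bar>real n - real r\<bar>)"
        using True by (simp add: \<epsilon>_def field_simps)
      then have "real k powr (real r * \<beta> - (real r - real n - 1 - \<epsilon> * \<bar>real n - real r\<bar>))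
          \<le> real k powr (1 + (real n * \<beta> - \<eta> * \<bar>real n - real r\<bar>))"
        using k_gt_1 by (intro powr_mono) auto
      also have "\<dots> = real k * real k powr (real n * \<beta> - \<eta> * \<bar>real n - real r\<bar>)"
        by (simp add: powr_add)
      finally have "C / c * real k powr (real r * \<beta> - (real r - real n - 1 - \<epsilon> * \<bar>real n - real r\<bar>))
          \<le> C / c * (real k * real k powr (real n * \<beta> - \<eta> * \<bar>real n - real r\<bar>))"
        using C c by (intro mult_left_mono) auto
      then show ?thesis using True by (simp add: m_def powr_diff)
    next
      case False
      have "\<eta> * (real n - real r) \<le> \<beta> * (real n - real r)"
        using False \<eta> by (intro mult_right_mono) auto
      then have "real k powr (real r * \<beta>) \<le> real k powr (real n * \<beta> - \<eta> * \<bar>real n - real r\<bar>)"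
        using False k_gt_1 by (intro powr_mono) (auto simp: algebra_simps)
      also have "\<dots> \<le> real k / c * real k powr (real n * \<beta> - \<eta> * \<bar>real n - real r\<bar>)"
      proof -
        have "1 \<le> real k / c" using c c1 k_gt_1 by (simp add: le_divide_eq)
        then show ?thesis using mult_right_mono[OF _ powr_ge_zero] by (metis mult_1)
      qed
      finally have "C * real k powr (real r * \<beta>)
          \<le> C * (real k / c * real k powr (real n * \<beta> - \<eta> * \<bar>real n - real r\<bar>))"
        using C by (intro mult_left_mono) auto
      then show ?thesis using False by (simp add: m_def)
    qed
    have "{y \<in> ktree k. l < sphere_mean k r g y} \<subseteq> (\<Union>n. F n)"
    proof
      fix y assume "y \<in> {y \<in> ktree k. l < sphere_mean k r g y}"
      then have y: "y \<in> ktree k" "l < sphere_mean k r g y" by auto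
      from exists_large_level_set[OF k y(1) g l \<epsilon> y(2)]
      obtain n where "0 < card (level_set k g l n \<inter> tree_sphere k y r)"
        "c * real k powr (real r - real n - 1 - \<epsilon> * \<bar>real n - real r\<bar>)
          \<le> real (card (level_set k g l n \<inter> tree_sphere k y r))"
        unfolding c_def by blast
      then have "y \<in> F n" using y by (auto simp: F_def m_def Suc_le_eq)
      then show "y \<in> (\<Union>n. F n)" by blast
    qed
    then have "emeasure (weight_measure k u) {y \<in> ktree k. l < sphere_mean k r g y}
        \<le> emeasure (weight_measure k u) (\<Union>n. F n)"
      by (intro emeasure_mono) (auto simp: F_def)
    also have "\<dots> \<le> (\<Sum>n. emeasure (weight_measure k u) (F n))"
      by (intro emeasure_subadditive_countably) (auto simp: F_def)
    also have "\<dots> \<le> (\<Sum>n. ennreal (K * real k powr (real n * q - \<delta> * \<bar>real n - real r\<bar>)) *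
              emeasure (weight_measure k v) (level_set k g l n))"
    proof (intro suminf_le allI)
      fix n
      have "(C * real k powr (real r * \<beta>) / m n) powr (p / \<alpha>)
          \<le> (C * real k / c * real k powr (real n * \<beta> - \<eta> * \<bar>real n - real r\<bar>)) powr (p / \<alpha>)"
        using ratio C m[of n] p \<alpha>_pos by (intro powr_mono2) auto
      also have "\<dots> = K * real k powr ((real n * \<beta> - \<eta> * \<bar>real n - real r\<bar>) * (p / \<alpha>))"
        unfolding K_def using C c by (subst powr_mult) (auto simp: powr_powr)
      also have "(real n * \<beta> - \<eta> * \<bar>real n - real r\<bar>) * (p / \<alpha>) = real n * q - \<delta> * \<bar>real n - real r\<bar>"
        by (simp add: \<delta>_def algebra_simps)
      finally have const: "(C * real k powr (real r * \<beta>) / m n) powr (p / \<alpha>)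
          \<le> K * real k powr (real n * q - \<delta> * \<bar>real n - real r\<bar>)" .
      have "emeasure (weight_measure k u) (F n)
          \<le> ennreal ((C * real k powr (real r * \<beta>) / m n) powr (p / \<alpha>)) *
            emeasure (weight_measure k v) (level_set k g l n)"
        by (rule emeasure_le_of_card[OF level_set_subset _ m]) (auto simp: F_def)
      also have "\<dots> \<le> ennreal (K * real k powr (real n * q - \<delta> * \<bar>real n - real r\<bar>)) *
            emeasure (weight_measure k v) (level_set k g l n)"
        using const by (intro mult_right_mono ennreal_leI) auto
      finally show "emeasure (weight_measure k u) (F n)
          \<le> ennreal (K * real k powr (real n * q - \<delta> * \<bar>real n - real r\<bar>)) *
            emeasure (weight_measure k v) (level_set k g l n)" .
    qed auto
    finally show "emeasure (weight_measure k u) {y \<in> ktree k. l < sphere_mean k r g y}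
        \<le> (\<Sum>n. ennreal (K * real k powr (real n * q - \<delta> * \<bar>real n - real r\<bar>)) *
              emeasure (weight_measure k v) (level_set k g l n))" .
  qed
qed

text \<open>After exchanging the sums, the sum over \<open>r\<close> is geometric in
  \<open>|n - r|\<close> and leaves \<open>D * k powr (n * q)\<close> on level \<open>n\<close>,
  where \<open>k powr (n * q)\<close> is at most \<open>(k ^ 3 * g x / l) powr q\<close>.\<close>

lemma weak_type:
  obtains K where "0 < K"
    "\<And>g l. (\<And>x. 0 \<le> g x) \<Longrightarrow> 0 < l \<Longrightarrow>
      emeasure (weight_measure k u) {x \<in> ktree k. \<exists>r. l < sphere_mean k r g x}
        \<le> ennreal K * (\<integral>\<^sup>+x. ennreal ((g x / l) powr q) \<partial>weight_measure k v)"
proof (rule emeasure_sphere_mean_gt)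
  fix K \<delta> assume K: "0 < K" and \<delta>: "0 < \<delta>" and *: "\<And>g l r. (\<And>x. 0 \<le> g x) \<Longrightarrow> 0 < l \<Longrightarrow>
      emeasure (weight_measure k u) {y \<in> ktree k. l < sphere_mean k r g y}
        \<le> (\<Sum>n. ennreal (K * real k powr (real n * q - \<delta> * \<bar>real n - real r\<bar>)) *
              emeasure (weight_measure k v) (level_set k g l n))"
  define D where "D = 2 / (1 - real k powr (- \<delta>))"
  have D: "0 < D" using \<delta> k_gt_1 by (simp add: D_def powr_less_one)
  define K' where "K' = K * D * (real k ^ 3) powr q"
  show thesis
  proof
    show "0 < K'" using K D k by (simp add: K'_def)
    fix g :: "nat list \<Rightarrow> real" and l :: real
    assume g: "\<And>x. 0 \<le> g x" and l: "0 < l"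
    let ?e = "\<lambda>n. emeasure (weight_measure k v) (level_set k g l n)"
    let ?I = "\<integral>\<^sup>+x. ennreal ((g x / l) powr q) \<partial>weight_measure k v"
    have "{x \<in> ktree k. \<exists>r. l < sphere_mean k r g x} = (\<Union>r. {x \<in> ktree k. l < sphere_mean k r g x})"
      by auto
    then have "emeasure (weight_measure k u) {x \<in> ktree k. \<exists>r. l < sphere_mean k r g x}
        \<le> (\<Sum>r. emeasure (weight_measure k u) {x \<in> ktree k. l < sphere_mean k r g x})"
      by (simp only:) (intro emeasure_subadditive_countably, auto)
    also have "\<dots> \<le> (\<Sum>r. \<Sum>n. ennreal (K * real k powr (real n * q - \<delta> * \<bar>real n - real r\<bar>)) * ?e n)"
      by (intro suminf_le allI *[OF g l]) auto
    also have "\<dots> = (\<Sum>n. \<Sum>r. ennreal (K * real k powr (real n * q - \<delta> * \<bar>real n - real r\<bar>)) * ?e n)"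
      unfolding nn_integral_count_space_nat[symmetric]
      by (rule nn_integral_count_space_nn_integral) auto
    also have "\<dots> \<le> (\<Sum>n. ennreal (K * D) * (ennreal (real k powr (real n * q)) * ?e n))"
    proof (intro suminf_le allI)
      fix n
      have "(\<Sum>r. ennreal (K * real k powr (real n * q - \<delta> * \<bar>real n - real r\<bar>)))
          \<le> ennreal (K * D * real k powr (real n * q))"
      proof (rule suminf_le_const)
        fix N
        have "(\<Sum>r<N. K * real k powr (real n * q - \<delta> * \<bar>real n - real r\<bar>))
            = K * real k powr (real n * q) * (\<Sum>r<N. real k powr (- \<delta> * \<bar>real r - real n\<bar>))"
          unfolding sum_distrib_left
          by (intro sum.cong refl) (simp add: abs_minus_commute powr_add[symmetric] mult.assoc)
        also have "\<dots> \<le> K * real k powr (real n * q) * D"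
          unfolding D_def using K \<delta> k_gt_1 by (intro mult_left_mono sum_powr_dist_le) auto
        finally show "(\<Sum>r<N. ennreal (K * real k powr (real n * q - \<delta> * \<bar>real n - real r\<bar>)))
            \<le> ennreal (K * D * real k powr (real n * q))"
          using K by (subst sum_ennreal) (auto simp: mult_ac intro!: ennreal_leI)
      qed auto
      then have "(\<Sum>r. ennreal (K * real k powr (real n * q - \<delta> * \<bar>real n - real r\<bar>))) * ?e n
          \<le> ennreal (K * D * real k powr (real n * q)) * ?e n"
        by (rule mult_right_mono) simp
      then show "(\<Sum>r. ennreal (K * real k powr (real n * q - \<delta> * \<bar>real n - real r\<bar>)) * ?e n)
          \<le> ennreal (K * D) * (ennreal (real k powr (real n * q)) * ?e n)"
        using K D by (simp add: ennreal_mult mult.assoc)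
    qed auto
    also have "\<dots> = ennreal (K * D) * (\<Sum>n. ennreal (real k powr (real n * q)) * ?e n)"
      by simp
    also have "(\<Sum>n. ennreal (real k powr (real n * q)) * ?e n)
        = (\<Sum>n. \<integral>\<^sup>+x. ennreal (real k powr (real n * q)) * indicator (level_set k g l n) x \<partial>weight_measure k v)"
      using level_set_subset by (intro suminf_cong) (simp add: nn_integral_cmult_indicator)
    also have "\<dots> = (\<integral>\<^sup>+x. (\<Sum>n. ennreal (real k powr (real n * q)) * indicator (level_set k g l n) x) \<partial>weight_measure k v)"
      by (rule nn_integral_suminf[symmetric]) auto
    \<comment> \<open>The level sets are disjoint, so at each point at most one \<open>n\<close>
      contributes.\<close>
    also have "\<dots> \<le> (\<integral>\<^sup>+x. ennreal ((real k ^ 3) powr q) * ennreal ((g x / l) powr q) \<partial>weight_measure k v)"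
    proof (rule nn_integral_mono)
      fix x
      show "(\<Sum>n. ennreal (real k powr (real n * q)) * indicator (level_set k g l n) x)
          \<le> ennreal ((real k ^ 3) powr q) * ennreal ((g x / l) powr q)"
        unfolding nn_integral_count_space_nat[symmetric]
      proof (rule nn_integral_le_of_unique)
        fix n m
        assume "ennreal (real k powr (real n * q)) * indicator (level_set k g l n) x \<noteq> 0"
          "ennreal (real k powr (real m * q)) * indicator (level_set k g l m) x \<noteq> 0"
        then show "n = m"
          using level_set_unique[OF k] by (auto simp: indicator_def split: if_splits)
      next
        fix n
        show "ennreal (real k powr (real n * q)) * indicator (level_set k g l n) x
            \<le> ennreal ((real k ^ 3) powr q) * ennreal ((g x / l) powr q)"
        proof (cases "x \<in> level_set k g l n")
          case True
          then have "real k ^ n \<le> real k ^ 3 * (g x / l)" by (simp add: level_set_def)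
          then have "(real k powr real n) powr q \<le> (real k ^ 3 * (g x / l)) powr q"
            using q_pos k by (intro powr_mono2) (auto simp: powr_realpow)
          then have "real k powr (real n * q) \<le> (real k ^ 3) powr q * (g x / l) powr q"
            by (simp only: powr_powr powr_mult)
          then show ?thesis using True by (simp add: ennreal_mult[symmetric] ennreal_leI)
        qed simp
      qed
    qed
    also have "\<dots> = ennreal ((real k ^ 3) powr q) * ?I"
      by (rule nn_integral_cmult) simp
    finally show "emeasure (weight_measure k u) {x \<in> ktree k. \<exists>r. l < sphere_mean k r g x} \<le> ennreal K' * ?I"
      using K D by (simp add: K'_def ennreal_mult mult.assoc mult_left_mono)
  qed
qed

section \<open>Strong type with decay in the radius\<close>

text \<open>A layer-cake sum over the heights \<open>k powr j\<close>, with the distribution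
  estimate at each height. For fixed \<open>n\<close>, summing over \<open>j\<close> recovers the
  integral of \<open>g powr p\<close> with factor \<open>k powr ((4 - n) * p)\<close>. As
  \<open>q < p\<close>, this outweighs \<open>k powr (n * q)\<close>, and the sum over
  \<open>n\<close> keeps decay in \<open>r\<close>.\<close>

lemma strong_type_sphere_mean:
  assumes \<beta>\<alpha>: "\<beta> < \<alpha>"
  obtains K \<delta> where "0 < K" "0 < \<delta>"
    "\<And>g r. (\<And>x. 0 \<le> g x) \<Longrightarrow>
      (\<integral>\<^sup>+x. ennreal (sphere_mean k r g x powr p) \<partial>weight_measure k u)
        \<le> ennreal (K * real k powr (- \<delta> * real r)) * (\<integral>\<^sup>+x. ennreal (g x powr p) \<partial>weight_measure k v)"
proof (rule emeasure_sphere_mean_gt)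
  fix K \<delta>0 assume K: "0 < K" and \<delta>0: "0 < \<delta>0" and *: "\<And>g l r. (\<And>x. 0 \<le> g x) \<Longrightarrow> 0 < l \<Longrightarrow>
      emeasure (weight_measure k u) {y \<in> ktree k. l < sphere_mean k r g y}
        \<le> (\<Sum>n. ennreal (K * real k powr (real n * q - \<delta>0 * \<bar>real n - real r\<bar>)) *
              emeasure (weight_measure k v) (level_set k g l n))"
  have qp: "q < p" using \<beta>\<alpha> \<alpha>_pos p by (simp add: field_simps)
  \<comment> \<open>At most half of the gap \<open>p - q\<close> pays for the decay in
    \<open>r\<close>; the remainder \<open>p - q - \<delta>\<close> stays positive and makes the sum
    over \<open>n\<close> geometric.\<close>
  define \<delta> where "\<delta> = min \<delta>0 ((p - q) / 2)"
  have "\<delta> \<le> (p - q) / 2" unfolding \<delta>_def by (rule min.cobounded2)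
  with qp have \<delta>: "0 < \<delta>" "\<delta> \<le> \<delta>0" "0 < p - q - \<delta>"
    using \<delta>0 by (auto simp: \<delta>_def)
  define D where "D = 2 / (1 - real k powr (- (p - q - \<delta>)))"
  have D: "0 < D" using \<delta> k_gt_1 unfolding D_def by (intro divide_pos_pos) (auto simp: powr_less_one)
  \<comment> \<open>The 4 combines the shift by 3 in \<open>level_set\<close> with the one power of
    \<open>k\<close> lost by discretising the heights.\<close>
  define K' where "K' = K * real k powr (4 * p) * D"
  show thesis
  proof
    show "0 < K'" using K D k by (simp add: K'_def)
    show "0 < \<delta>" by (rule \<delta>)
    fix g :: "nat list \<Rightarrow> real" and r :: nat
    assume g: "\<And>x. 0 \<le> g x"
    define h where "h = sphere_mean k r g"
    have h: "0 \<le> h x" for x unfolding h_def by (rule sphere_mean_nonneg[OF g])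
    let ?U = "weight_measure k u" and ?V = "weight_measure k v"
    let ?I = "\<integral>\<^sup>+x. ennreal (g x powr p) \<partial>?V"
    define L where "L j = {x \<in> ktree k. real k powr real_of_int j < h x}" for j :: int
    define E where "E j n = level_set k g (real k powr real_of_int j) n" for j :: int and n
    define a where "a n = K * real k powr (real n * q - \<delta>0 * \<bar>real n - real r\<bar>)" for n :: nat
    define b where "b j = real k powr ((real_of_int j + 1) * p)" for j :: int
    have L: "L j \<subseteq> ktree k" and E: "E j n \<subseteq> ktree k" for j n
      using level_set_subset by (auto simp: L_def E_def)
    have "(\<integral>\<^sup>+x. ennreal (h x powr p) \<partial>?U)
        \<le> (\<integral>\<^sup>+x. \<integral>\<^sup>+j. ennreal (b j) * indicator (L j) x \<partial>count_space UNIV \<partial>?U)"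
    proof (rule nn_integral_mono)
      fix x assume "x \<in> space ?U"
      then have x: "x \<in> ktree k" by simp
      show "ennreal (h x powr p) \<le> (\<integral>\<^sup>+j. ennreal (b j) * indicator (L j) x \<partial>count_space UNIV)"
      proof (cases "h x = 0")
        case False
        with h[of x] have hx: "0 < h x" by simp
        \<comment> \<open>Ceiling minus one gives the strict \<open>k powr j < h x\<close> that
          membership in \<open>L j\<close> requires, together with
          \<open>h x \<le> k powr (j + 1)\<close>.\<close>
        define j where "j = \<lceil>log (real k) (h x)\<rceil> - 1"
        have "real_of_int j < log (real k) (h x)" "log (real k) (h x) \<le> real_of_int j + 1"
          unfolding j_def by linarith+
        then have j: "real k powr real_of_int j < h x" "h x \<le> real k powr (real_of_int j + 1)"
          using hx k_gt_1 by (simp_all add: less_log_iff log_le_iff)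
        have "h x powr p \<le> (real k powr (real_of_int j + 1)) powr p"
          using j hx p by (intro powr_mono2) auto
        then have "ennreal (h x powr p) \<le> ennreal (b j) * indicator (L j) x"
          using j x by (auto simp: b_def L_def powr_powr intro: ennreal_leI)
        also have "\<dots> \<le> (\<integral>\<^sup>+j. ennreal (b j) * indicator (L j) x \<partial>count_space UNIV)"
          by (rule nn_integral_ge_point) simp
        finally show ?thesis .
      qed simp
    qed
    also have "\<dots> = (\<integral>\<^sup>+j. \<integral>\<^sup>+x. ennreal (b j) * indicator (L j) x \<partial>?U \<partial>count_space UNIV)"
      by (rule nn_integral_count_space_nn_integral) auto
    also have "\<dots> = (\<integral>\<^sup>+j. ennreal (b j) * emeasure ?U (L j) \<partial>count_space UNIV)"
      using L by (intro nn_integral_cong) (simp add: nn_integral_cmult_indicator)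
    also have "\<dots> \<le> (\<integral>\<^sup>+j. ennreal (b j) * (\<Sum>n. ennreal (a n) * emeasure ?V (E j n)) \<partial>count_space UNIV)"
      unfolding L_def E_def a_def h_def using k_gt_1
      by (intro nn_integral_mono mult_left_mono *[OF g]) auto
    also have "\<dots> = (\<integral>\<^sup>+j. \<integral>\<^sup>+n. ennreal (a n) * (ennreal (b j) * emeasure ?V (E j n)) \<partial>count_space UNIV \<partial>count_space UNIV)"
      unfolding nn_integral_count_space_nat
      by (intro nn_integral_cong) (simp add: ennreal_suminf_cmult[symmetric] mult.left_commute del: ennreal_suminf_cmult)
    also have "\<dots> = (\<integral>\<^sup>+n. \<integral>\<^sup>+j. ennreal (a n) * (ennreal (b j) * emeasure ?V (E j n)) \<partial>count_space UNIV \<partial>count_space UNIV)"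
      by (rule nn_integral_count_space_nn_integral) auto
    also have "\<dots> = (\<integral>\<^sup>+n. ennreal (a n) * (\<integral>\<^sup>+j. ennreal (b j) * emeasure ?V (E j n) \<partial>count_space UNIV) \<partial>count_space UNIV)"
      by (intro nn_integral_cong nn_integral_cmult) simp
    also have "\<dots> \<le> (\<integral>\<^sup>+n. ennreal (a n) * (ennreal (real k powr ((4 - real n) * p)) * ?I) \<partial>count_space UNIV)"
    proof (intro nn_integral_mono mult_left_mono)
      fix n :: nat
      have "(\<integral>\<^sup>+j. ennreal (b j) * emeasure ?V (E j n) \<partial>count_space UNIV)
          = (\<integral>\<^sup>+j. \<integral>\<^sup>+x. ennreal (b j) * indicator (E j n) x \<partial>?V \<partial>count_space UNIV)"
        using E by (intro nn_integral_cong) (simp add: nn_integral_cmult_indicator)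
      also have "\<dots> = (\<integral>\<^sup>+x. \<integral>\<^sup>+j. ennreal (b j) * indicator (E j n) x \<partial>count_space UNIV \<partial>?V)"
        by (rule nn_integral_count_space_nn_integral[symmetric]) auto
      \<comment> \<open>A point has level \<open>n\<close> at no more than one height
        \<open>k powr j\<close>, and there
        \<open>k powr (j + 1) \<le> k powr (4 - n) * g x\<close>.\<close>
      also have "\<dots> \<le> (\<integral>\<^sup>+x. ennreal (real k powr ((4 - real n) * p)) * ennreal (g x powr p) \<partial>?V)"
      proof (intro nn_integral_mono nn_integral_le_of_unique)
        fix x and i j :: int
        assume "ennreal (b i) * indicator (E i n) x \<noteq> 0" "ennreal (b j) * indicator (E j n) x \<noteq> 0"
        then have "x \<in> E i n" "x \<in> E j n" by (auto simp: indicator_def split: if_splits)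
        then have "i < j + 1" "j < i + 1"
          using level_set_scale_less[OF k] unfolding E_def by blast+
        then show "i = j" by simp
      next
        fix x and j :: int
        show "ennreal (b j) * indicator (E j n) x
            \<le> ennreal (real k powr ((4 - real n) * p)) * ennreal (g x powr p)"
        proof (cases "x \<in> E j n")
          case True
          then have "real k powr real n \<le> real k powr 3 * g x / real k powr real_of_int j"
            using k_gt_1 by (simp add: E_def level_set_def powr_realpow)
          then have "real k powr (real_of_int j + 1) \<le> real k powr (4 - real n) * g x"
            using k_gt_1 by (simp add: powr_add powr_diff field_simps power4_eq_xxxx power3_eq_cube)
          then have "(real k powr (real_of_int j + 1)) powr p \<le> (real k powr (4 - real n) * g x) powr p"
            using p by (intro powr_mono2) auto
          then have "b j \<le> real k powr ((4 - real n) * p) * g x powr p"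
            by (simp only: b_def powr_powr powr_mult)
          then show ?thesis using True by (simp add: ennreal_mult[symmetric] ennreal_leI)
        qed simp
      qed
      also have "\<dots> = ennreal (real k powr ((4 - real n) * p)) * ?I"
        by (rule nn_integral_cmult) simp
      finally show "(\<integral>\<^sup>+j. ennreal (b j) * emeasure ?V (E j n) \<partial>count_space UNIV)
          \<le> ennreal (real k powr ((4 - real n) * p)) * ?I" .
    qed simp
    also have "\<dots> = (\<integral>\<^sup>+n. ennreal (a n * real k powr ((4 - real n) * p)) * ?I \<partial>count_space UNIV)"
      using K by (intro nn_integral_cong) (simp add: a_def ennreal_mult mult.assoc)
    also have "\<dots> = (\<Sum>n. ennreal (a n * real k powr ((4 - real n) * p))) * ?I"
      by (simp add: nn_integral_count_space_nat)
    also have "\<dots> \<le> ennreal (K' * real k powr (- \<delta> * real r)) * ?I"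
    proof (intro mult_right_mono suminf_le_const)
      fix N
      have "(\<Sum>n<N. a n * real k powr ((4 - real n) * p))
          \<le> (\<Sum>n<N. K * real k powr (4 * p) * real k powr (- \<delta> * real r) * real k powr (- (p - q - \<delta>) * \<bar>real n - real 0\<bar>))"
      proof (rule sum_mono)
        fix n
        \<comment> \<open>Replacing \<open>\<delta>0 * |n - r|\<close> by the smaller
          \<open>\<delta> * (r - n)\<close> separates the exponent into a part in \<open>r\<close>
          and a part in \<open>n\<close>.\<close>
        have "\<delta> * (real r - real n) \<le> \<delta> * \<bar>real n - real r\<bar>"
          using \<delta> by (intro mult_left_mono) auto
        also have "\<dots> \<le> \<delta>0 * \<bar>real n - real r\<bar>"
          using \<delta> by (intro mult_right_mono) auto
        finally have "real n * q - \<delta>0 * \<bar>real n - real r\<bar> + (4 - real n) * p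
            \<le> 4 * p + - \<delta> * real r + - (p - q - \<delta>) * \<bar>real n - real 0\<bar>"
          by (simp add: algebra_simps)
        then have "K * real k powr (real n * q - \<delta>0 * \<bar>real n - real r\<bar> + (4 - real n) * p)
            \<le> K * real k powr (4 * p + - \<delta> * real r + - (p - q - \<delta>) * \<bar>real n - real 0\<bar>)"
          using K k_gt_1 by (intro mult_left_mono powr_mono) auto
        then show "a n * real k powr ((4 - real n) * p)
            \<le> K * real k powr (4 * p) * real k powr (- \<delta> * real r) * real k powr (- (p - q - \<delta>) * \<bar>real n - real 0\<bar>)"
          by (simp only: a_def powr_add mult.assoc)
      qed
      also have "\<dots> = K * real k powr (4 * p) * real k powr (- \<delta> * real r) * (\<Sum>n<N. real k powr (- (p - q - \<delta>) * \<bar>real n - real 0\<bar>))"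
        by (rule sum_distrib_left[symmetric])
      also have "\<dots> \<le> K * real k powr (4 * p) * real k powr (- \<delta> * real r) * D"
        unfolding D_def using K \<delta> k_gt_1 by (intro mult_left_mono sum_powr_dist_le) auto
      also have "\<dots> = K' * real k powr (- \<delta> * real r)"
        by (simp add: K'_def)
      finally show "(\<Sum>n<N. ennreal (a n * real k powr ((4 - real n) * p))) \<le> ennreal (K' * real k powr (- \<delta> * real r))"
        using K by (subst sum_ennreal) (auto simp: a_def intro!: ennreal_leI)
    qed auto
    finally show "(\<integral>\<^sup>+x. ennreal (sphere_mean k r g x powr p) \<partial>?U)
        \<le> ennreal (K' * real k powr (- \<delta> * real r)) * ?I"
      by (simp only: h_def)
  qed
qed

end

section \<open>Duality for the spherical means\<close>

text \<open>Young's inequality for \<open>s * a\<close> and \<open>b / s\<close>, where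
  \<open>s powr p = N / w\<close>. This choice puts \<open>1 / N\<close> before
  \<open>b powr p * w\<close>, ready to be absorbed by an operator bound with constant
  \<open>N\<close>, and turns the weight of the other term into the dual weight.\<close>

lemma Youngs_inequality_weighted:
  fixes N p w a b :: real
  assumes p: "1 < p" and N: "0 < N" and w: "0 < w" and ab: "0 \<le> a" "0 \<le> b"
  shows "a * b \<le> (1 - 1 / p) * (N powr (1 / (p - 1)) * (a powr (p / (p - 1)) * w powr (- 1 / (p - 1))))
    + 1 / p * (1 / N * (b powr p * w))"
proof -
  define p' where "p' = p / (p - 1)"
  define s where "s = (N / w) powr (1 / p)"
  have p': "1 < p'" "1 / p' = 1 - 1 / p" "1 / p' + 1 / p = 1" "1 / p * p' = 1 / (p - 1)"
    using p by (auto simp: p'_def field_simps)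
  have s: "0 < s" "s powr p = N / w" using N w p by (auto simp: s_def powr_powr)
  have sp': "s powr p' = N powr (1 / (p - 1)) * w powr (- 1 / (p - 1))"
    using N w p'(4) by (simp add: s_def powr_powr powr_divide powr_minus_divide)
  have "a * b = (s * a) * (b / s)" using s by simp
  also have "\<dots> \<le> (s * a) powr p' / p' + (b / s) powr p / p"
    using p p' s ab by (intro Youngs_inequality) auto
  also have "(s * a) powr p' / p' = (1 / p') * (s powr p' * a powr p')"
    by (simp add: powr_mult)
  also have "(b / s) powr p = 1 / N * (b powr p * w)"
    using s ab by (simp add: powr_divide)
  finally show ?thesis
    unfolding sp' p'(2) by (simp add: p'_def mult_ac)
qed

text \<open>
  The spherical mean is symmetric for the counting measure, so its adjoint bound has the same
  constant. Testing on \<open>\<phi> = h\<^bsup>1/(p-1)\<^esup> \<sigma>\<^bsub>v,p\<^esub>\<close> restricted to a finite set, where \<open>h\<close> is the mean of \<open>g\<close>,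
  makes \<open>\<phi>\<^bsup>p\<^esup> v = h\<^bsup>p'\<^esup> \<sigma>\<^bsub>v,p\<^esub>\<close>, which is absorbed on the left after Young's inequality.
\<close>

lemma sphere_mean_dual:
  fixes N p :: real
  assumes p: "1 < p" and N: "0 < N" and u: "is_weight k u" and v: "is_weight k v"
    and strong: "\<And>g. (\<And>x. 0 \<le> g x) \<Longrightarrow>
      (\<integral>\<^sup>+x. ennreal (sphere_mean k r g x powr p) \<partial>weight_measure k u)
        \<le> ennreal N * (\<integral>\<^sup>+x. ennreal (g x powr p) \<partial>weight_measure k v)"
    and g: "\<And>x. 0 \<le> g x"
  shows "(\<integral>\<^sup>+x. ennreal (sphere_mean k r g x powr (p / (p - 1))) \<partial>weight_measure k (dual_weight v p))
    \<le> ennreal (N powr (1 / (p - 1))) *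
      (\<integral>\<^sup>+x. ennreal (g x powr (p / (p - 1))) \<partial>weight_measure k (dual_weight u p))"
proof (rule nn_integral_weight_measure_le)
  fix A assume A: "finite A" "A \<subseteq> ktree k"
  define p' where "p' = p / (p - 1)"
  define M where "M = N powr (1 / (p - 1))"
  define h where "h = sphere_mean k r g"
  define \<phi> where "\<phi> x = (if x \<in> A then h x powr (1 / (p - 1)) * dual_weight v p x else 0)" for x
  define B where "B = (\<Union>x\<in>A. tree_sphere k x r)"
  define X where "X = (\<Sum>x\<in>A. dual_weight v p x * h x powr p')"
  define G where "G = (\<Sum>y\<in>B. dual_weight u p y * g y powr p')"
  define H where "H = (\<Sum>y\<in>B. u y * sphere_mean k r \<phi> y powr p)"
  have B: "finite B" "B \<subseteq> ktree k"
    using A by (auto simp: B_def finite_tree_sphere subset_iff) (auto simp: tree_sphere_def)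
  have dual0: "0 \<le> dual_weight w p x" for w x by (simp add: dual_weight_def)
  have h: "0 \<le> h x" for x unfolding h_def by (rule sphere_mean_nonneg[OF g])
  have \<phi>: "0 \<le> \<phi> x" for x by (simp add: \<phi>_def dual0)
  have X0: "0 \<le> X" by (simp add: X_def sum_nonneg dual0)
  have M0: "0 \<le> M" by (simp add: M_def)
  have pp: "1 + 1 / (p - 1) = p'" "1 / (p - 1) * p = p'" using p by (auto simp: p'_def field_simps)
  have "X = (\<Sum>x\<in>A. \<phi> x * h x)"
    unfolding X_def pp(1)[symmetric]
    by (intro sum.cong refl) (simp add: \<phi>_def powr_mult_base[OF h, symmetric] mult_ac)
  also have "\<dots> = (\<Sum>y\<in>B. g y * sphere_mean k r \<phi> y)"
    unfolding h_def using A B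
    by (intro sum_sphere_mean_symmetric) (auto simp: B_def \<phi>_def)
  also have "\<dots> \<le> (\<Sum>y\<in>B. (1 - 1 / p) * (M * (dual_weight u p y * g y powr p'))
      + 1 / p * (1 / N * (u y * sphere_mean k r \<phi> y powr p)))"
  proof (rule sum_mono)
    fix y assume "y \<in> B"
    then have "0 < u y" using B u by (auto simp: is_weight_def)
    from Youngs_inequality_weighted[OF p N this g[of y] sphere_mean_nonneg[OF \<phi>]]
    show "g y * sphere_mean k r \<phi> y \<le> (1 - 1 / p) * (M * (dual_weight u p y * g y powr p'))
      + 1 / p * (1 / N * (u y * sphere_mean k r \<phi> y powr p))"
      by (simp only: M_def p'_def dual_weight_def mult_ac)
  qed
  also have "\<dots> = (1 - 1 / p) * (M * G) + 1 / p * (1 / N * H)"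
    by (simp only: G_def H_def sum.distrib sum_distrib_left)
  finally have young: "X \<le> (1 - 1 / p) * (M * G) + 1 / p * (1 / N * H)" .
  have "1 / N * H \<le> X"
  proof -
    have "ennreal H = (\<Sum>y\<in>B. ennreal (u y) * ennreal (sphere_mean k r \<phi> y powr p))"
      unfolding H_def using B u
      by (subst sum_ennreal[symmetric]) (auto simp: is_weight_def less_imp_le subset_iff ennreal_mult)
    also have "\<dots> \<le> (\<integral>\<^sup>+x. ennreal (sphere_mean k r \<phi> x powr p) \<partial>weight_measure k u)"
      by (rule sum_le_nn_integral_weight_measure[OF B])
    also have "\<dots> \<le> ennreal N * (\<integral>\<^sup>+x. ennreal (\<phi> x powr p) \<partial>weight_measure k v)"
      by (rule strong[OF \<phi>])
    also have "(\<integral>\<^sup>+x. ennreal (\<phi> x powr p) \<partial>weight_measure k v) = (\<Sum>x\<in>A. ennreal (v x) * ennreal (\<phi> x powr p))"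
      unfolding nn_integral_weight_measure using A
      by (intro nn_integral_count_space') (auto simp: \<phi>_def)
    also have "\<dots> = (\<Sum>x\<in>A. ennreal (dual_weight v p x * h x powr p'))"
    proof (rule sum.cong[OF refl])
      fix x assume x: "x \<in> A"
      then have vx: "0 < v x" using A v by (auto simp: is_weight_def)
      have "v x * dual_weight v p x powr p = v x powr (1 + (- 1 / (p - 1)) * p)"
        using vx by (simp only: dual_weight_def powr_powr powr_add powr_one)
      also have "1 + (- 1 / (p - 1)) * p = - 1 / (p - 1)"
        using p by (simp add: field_simps)
      finally have "v x * \<phi> x powr p = dual_weight v p x * h x powr p'"
        using x pp(2) by (simp add: \<phi>_def powr_mult powr_powr dual_weight_def mult_ac)
      then show "ennreal (v x) * ennreal (\<phi> x powr p) = ennreal (dual_weight v p x * h x powr p')"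
        using vx by (simp add: ennreal_mult[symmetric])
    qed
    also have "\<dots> = ennreal X"
      unfolding X_def by (rule sum_ennreal) (simp add: dual0)
    also have "ennreal N * \<dots> = ennreal (N * X)"
      using N X0 by (simp add: ennreal_mult)
    finally have "H \<le> N * X" using N X0 by (simp add: ennreal_le_iff)
    then show ?thesis using N by (simp add: field_simps)
  qed
  then have "1 / p * (1 / N * H) \<le> 1 / p * X" using p by (intro mult_left_mono) auto
  \<comment> \<open>\<open>X\<close> is a real number because \<open>A\<close> is finite, so
    \<open>X / p\<close> can be subtracted from both sides.\<close>
  with young have "(1 - 1 / p) * X \<le> (1 - 1 / p) * (M * G)" by (simp add: algebra_simps)
  then have XG: "X \<le> M * G" using p by simp
  have "(\<Sum>x\<in>A. ennreal (dual_weight v p x) * ennreal (h x powr p')) = ennreal X"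
    unfolding X_def using dual0 by (subst sum_ennreal[symmetric]) (auto simp: ennreal_mult)
  also have "\<dots> \<le> ennreal M * ennreal G"
    using XG M0 by (simp add: ennreal_mult'[symmetric] ennreal_leI)
  also have "ennreal G = (\<Sum>y\<in>B. ennreal (dual_weight u p y) * ennreal (g y powr p'))"
    unfolding G_def using dual0 by (subst sum_ennreal[symmetric]) (auto simp: ennreal_mult)
  also have "ennreal M * \<dots> \<le> ennreal M * (\<integral>\<^sup>+x. ennreal (g x powr p') \<partial>weight_measure k (dual_weight u p))"
    by (intro mult_left_mono sum_le_nn_integral_weight_measure B) simp
  finally show "(\<Sum>x\<in>A. ennreal (dual_weight v p x) * ennreal (sphere_mean k r g x powr (p / (p - 1))))
    \<le> ennreal (N powr (1 / (p - 1))) *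
      (\<integral>\<^sup>+x. ennreal (g x powr (p / (p - 1))) \<partial>weight_measure k (dual_weight u p))"
    by (simp only: M_def p'_def h_def)
qed

section \<open>Bounds for the maximal function\<close>

lemma ennpow_ennreal: "0 \<le> x \<Longrightarrow> ennpow (ennreal x) a = ennreal (x powr a)"
  by (simp add: ennpow_def)

lemma ennpow_mono:
  assumes "s \<le> t" "0 \<le> a"
  shows "ennpow s a \<le> ennpow t a"
proof (cases t)
  case (real t')
  then obtain s' where "s = ennreal s'" "0 \<le> s'" using assms by (cases s) (auto simp: top_unique)
  with real assms show ?thesis
    by (auto simp: ennpow_ennreal intro!: ennreal_leI powr_mono2)
qed (simp add: ennpow_def)

lemma ennpow_cmult:
  assumes "0 < c"
  shows "ennpow (ennreal c * t) a = ennreal (c powr a) * ennpow t a"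
proof (cases t)
  case (real t')
  with assms show ?thesis
    by (simp add: ennreal_mult'[symmetric] ennpow_ennreal powr_mult)
next
  case top
  with assms show ?thesis by (simp add: ennpow_def ennreal_mult_top)
qed

text \<open>Each ball average is at most twice some spherical mean, and the \<open>s\<close>-th
  power of that double is a single term of the series. A divergent series leaves nothing to
  prove.\<close>

lemma maximal_le_sphere_means:
  assumes k: "2 \<le> k" and x: "x \<in> ktree k" and s: "0 < s"
  shows "ennpow (maximal k f x) s \<le> (\<Sum>r. ennreal ((2 * sphere_mean k r (\<lambda>y. cmod (f y)) x) powr s))"
proof -
  define m where "m r = 2 * sphere_mean k r (\<lambda>y. cmod (f y)) x" for r
  have m0: "0 \<le> m r" for r by (simp add: m_def sphere_mean_nonneg)
  have "ennpow (maximal k f x) s \<le> (\<Sum>r. ennreal (m r powr s))"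
  proof (cases "(\<Sum>r. ennreal (m r powr s)) = top")
    case False
    then obtain c where c: "(\<Sum>r. ennreal (m r powr s)) = ennreal c" "0 \<le> c"
      by (metis ennreal_cases)
    have "maximal k f x \<le> ennreal (c powr (1 / s))"
      unfolding maximal_def
    proof (intro SUP_least ennreal_leI)
      fix r
      obtain j where j: "(\<Sum>y\<in>tree_ball k x r. cmod (f y)) / real (card (tree_ball k x r)) \<le> m j"
        using ball_mean_le_sphere_mean[OF k x, of "\<lambda>y. cmod (f y)" r] by (auto simp: m_def)
      have "(\<Sum>r\<in>{j}. ennreal (m r powr s)) \<le> (\<Sum>r. ennreal (m r powr s))"
        by (rule sum_le_suminf) auto
      then have "m j powr s \<le> c" using c by simp
      then have "(m j powr s) powr (1 / s) \<le> c powr (1 / s)"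
        using s by (intro powr_mono2) auto
      then have "m j \<le> c powr (1 / s)"
        using s m0[of j] by (simp add: powr_powr)
      with j show "(\<Sum>y\<in>tree_ball k x r. cmod (f y)) / real (card (tree_ball k x r)) \<le> c powr (1 / s)"
        by (rule order_trans)
    qed
    then have "ennpow (maximal k f x) s \<le> ennpow (ennreal (c powr (1 / s))) s"
      using s by (intro ennpow_mono) auto
    also have "\<dots> = ennreal c"
      using c s by (simp add: ennpow_ennreal powr_powr)
    finally show ?thesis using c by simp
  qed simp
  then show ?thesis by (simp only: m_def)
qed

text \<open>Integrating the series of \<open>s\<close>-th powers term by term leaves a convergent
  geometric series in \<open>r\<close>. The exponent and weights are general because the lemma is
  applied both to \<open>p\<close> with \<open>u\<close>, \<open>v\<close> and to the dual exponent
  with the dual weights.\<close>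

lemma maximal_strong_type:
  fixes s K \<delta> :: real
  assumes k: "2 \<le> k" and s: "0 < s" and K: "0 < K" and \<delta>: "0 < \<delta>"
    and *: "\<And>g r. (\<And>x. 0 \<le> g x) \<Longrightarrow>
      (\<integral>\<^sup>+x. ennreal (sphere_mean k r g x powr s) \<partial>weight_measure k w)
        \<le> ennreal (K * real k powr (- \<delta> * real r)) * (\<integral>\<^sup>+x. ennreal (g x powr s) \<partial>weight_measure k w')"
  shows "\<exists>C. 0 < C \<and> (\<forall>f. Lq_norm k w s (maximal k f)
    \<le> ennreal C * Lq_norm k w' s (\<lambda>x. ennreal (cmod (f x))))"
proof -
  \<comment> \<open>\<open>2 powr s\<close> comes from passing from balls to spheres; the last
    factor bounds the sum of \<open>k powr (- \<delta> * r)\<close>.\<close>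
  define D where "D = 2 powr s * K * (2 / (1 - real k powr (- \<delta>)))"
  have k1: "1 < real k" using k by simp
  have D: "0 < D" unfolding D_def using K \<delta> k1
    by (intro mult_pos_pos divide_pos_pos) (auto simp: powr_less_one)
  have "Lq_norm k w s (maximal k f) \<le> ennreal (D powr (1 / s)) * Lq_norm k w' s (\<lambda>x. ennreal (cmod (f x)))" for f
  proof -
    let ?g = "\<lambda>y. cmod (f y)"
    let ?I = "\<integral>\<^sup>+x. ennreal (?g x powr s) \<partial>weight_measure k w'"
    have "(\<integral>\<^sup>+x. ennpow (maximal k f x) s \<partial>weight_measure k w)
        \<le> (\<integral>\<^sup>+x. (\<Sum>r. ennreal ((2 * sphere_mean k r ?g x) powr s)) \<partial>weight_measure k w)"
      by (intro nn_integral_mono maximal_le_sphere_means k s) simp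
    also have "\<dots> = (\<Sum>r. \<integral>\<^sup>+x. ennreal ((2 * sphere_mean k r ?g x) powr s) \<partial>weight_measure k w)"
      by (rule nn_integral_suminf) simp
    also have "\<dots> \<le> (\<Sum>r. ennreal (2 powr s * K * real k powr (- \<delta> * real r)) * ?I)"
    proof (intro suminf_le allI)
      fix r
      have "(\<integral>\<^sup>+x. ennreal ((2 * sphere_mean k r ?g x) powr s) \<partial>weight_measure k w)
          = (\<integral>\<^sup>+x. ennreal (2 powr s) * ennreal (sphere_mean k r ?g x powr s) \<partial>weight_measure k w)"
        by (simp add: powr_mult ennreal_mult)
      also have "\<dots> = ennreal (2 powr s) * (\<integral>\<^sup>+x. ennreal (sphere_mean k r ?g x powr s) \<partial>weight_measure k w)"
        by (rule nn_integral_cmult) simp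
      also have "\<dots> \<le> ennreal (2 powr s) * (ennreal (K * real k powr (- \<delta> * real r)) * ?I)"
        by (intro mult_left_mono *) auto
      finally show "(\<integral>\<^sup>+x. ennreal ((2 * sphere_mean k r ?g x) powr s) \<partial>weight_measure k w)
          \<le> ennreal (2 powr s * K * real k powr (- \<delta> * real r)) * ?I"
        using K by (simp add: ennreal_mult mult.assoc)
    qed auto
    also have "\<dots> = (\<Sum>r. ennreal (2 powr s * K * real k powr (- \<delta> * real r))) * ?I"
      by simp
    also have "\<dots> \<le> ennreal D * ?I"
    proof (intro mult_right_mono suminf_le_const)
      fix n
      have "(\<Sum>r<n. real k powr (- \<delta> * \<bar>real r - real 0\<bar>)) \<le> 2 / (1 - real k powr (- \<delta>))"
        using k1 \<delta> by (intro sum_powr_dist_le) auto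
      then have "2 powr s * K * (\<Sum>r<n. real k powr (- \<delta> * real r)) \<le> D"
        unfolding D_def using K by (intro mult_left_mono) auto
      then show "(\<Sum>r<n. ennreal (2 powr s * K * real k powr (- \<delta> * real r))) \<le> ennreal D"
        using K by (subst sum_ennreal) (auto simp: sum_distrib_left intro!: ennreal_leI)
    qed auto
    finally have "ennpow (\<integral>\<^sup>+x. ennpow (maximal k f x) s \<partial>weight_measure k w) (1 / s)
        \<le> ennpow (ennreal D * ?I) (1 / s)"
      using s by (intro ennpow_mono) auto
    then show ?thesis
      by (simp only: Lq_norm_def ennpow_cmult[OF D] ennpow_ennreal[OF norm_ge_zero])
  qed
  moreover have "0 < D powr (1 / s)" using D by simp
  ultimately show ?thesis by blast
qed

text \<open>Where the maximal function exceeds \<open>t\<close>, some spherical mean exceeds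
  \<open>t / 2\<close>. The assumption at that height produces \<open>(2 / t) powr s\<close>, whose
  root of order \<open>s\<close> cancels the factor \<open>t\<close>.\<close>

lemma maximal_weak_type:
  fixes s K :: real
  assumes k: "2 \<le> k" and s: "0 < s" and K: "0 < K"
    and *: "\<And>g l. (\<And>x. 0 \<le> g x) \<Longrightarrow> 0 < l \<Longrightarrow>
      emeasure (weight_measure k w) {x \<in> ktree k. \<exists>r. l < sphere_mean k r g x}
        \<le> ennreal K * (\<integral>\<^sup>+x. ennreal ((g x / l) powr s) \<partial>weight_measure k w')"
  shows "\<exists>C. 0 < C \<and> (\<forall>f. weak_Lq_norm k w s (maximal k f)
    \<le> ennreal C * Lq_norm k w' s (\<lambda>x. ennreal (cmod (f x))))"
proof -
  have "weak_Lq_norm k w s (maximal k f)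
      \<le> ennreal (2 * K powr (1 / s)) * Lq_norm k w' s (\<lambda>x. ennreal (cmod (f x)))" for f
    unfolding weak_Lq_norm_def
  proof (rule SUP_least)
    fix t :: real assume "t \<in> {0<..}"
    then have t: "0 < t" by simp
    let ?g = "\<lambda>y. cmod (f y)"
    let ?I = "\<integral>\<^sup>+x. ennreal (?g x powr s) \<partial>weight_measure k w'"
    define c where "c = K * (2 / t) powr s"
    have c: "0 < c" using K t by (simp add: c_def)
    have "{x \<in> ktree k. ennreal t < maximal k f x} \<subseteq> {x \<in> ktree k. \<exists>r. t / 2 < sphere_mean k r ?g x}"
    proof clarify
      fix x assume x: "x \<in> ktree k" "ennreal t < maximal k f x"
      then obtain r where "ennreal t < ennreal ((\<Sum>y\<in>tree_ball k x r. ?g y) / real (card (tree_ball k x r)))"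
        by (auto simp: maximal_def less_SUP_iff)
      then have "t < (\<Sum>y\<in>tree_ball k x r. ?g y) / real (card (tree_ball k x r))"
        using t by (simp add: ennreal_less_iff)
      moreover obtain j where "(\<Sum>y\<in>tree_ball k x r. ?g y) / real (card (tree_ball k x r))
          \<le> 2 * sphere_mean k j ?g x"
        using ball_mean_le_sphere_mean[OF k x(1), of ?g r] by auto
      ultimately have "t / 2 < sphere_mean k j ?g x" by linarith
      then show "\<exists>r. t / 2 < sphere_mean k r ?g x" by blast
    qed
    then have "emeasure (weight_measure k w) {x \<in> ktree k. ennreal t < maximal k f x}
        \<le> emeasure (weight_measure k w) {x \<in> ktree k. \<exists>r. t / 2 < sphere_mean k r ?g x}"
      by (rule emeasure_mono) auto
    also have "\<dots> \<le> ennreal K * (\<integral>\<^sup>+x. ennreal ((?g x / (t / 2)) powr s) \<partial>weight_measure k w')"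
      using t by (intro *) auto
    also have "(\<integral>\<^sup>+x. ennreal ((?g x / (t / 2)) powr s) \<partial>weight_measure k w')
        = (\<integral>\<^sup>+x. ennreal ((2 / t) powr s) * ennreal (?g x powr s) \<partial>weight_measure k w')"
    proof (rule nn_integral_cong)
      fix x
      have "?g x / (t / 2) = 2 / t * ?g x" by simp
      then show "ennreal ((?g x / (t / 2)) powr s) = ennreal ((2 / t) powr s) * ennreal (?g x powr s)"
        by (simp only: powr_mult ennreal_mult powr_ge_zero)
    qed
    also have "\<dots> = ennreal ((2 / t) powr s) * ?I"
      by (rule nn_integral_cmult) simp
    also have "ennreal K * \<dots> = ennreal c * ?I"
      using K by (simp add: c_def ennreal_mult mult.assoc)
    finally have "ennpow (emeasure (weight_measure k w) {x \<in> ktree k. ennreal t < maximal k f x}) (1 / s)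
        \<le> ennpow (ennreal c * ?I) (1 / s)"
      using s by (intro ennpow_mono) auto
    also have "\<dots> = ennreal (c powr (1 / s)) * ennpow ?I (1 / s)"
      by (rule ennpow_cmult[OF c])
    finally have "ennreal t * ennpow (emeasure (weight_measure k w) {x \<in> ktree k. ennreal t < maximal k f x}) (1 / s)
        \<le> ennreal t * (ennreal (c powr (1 / s)) * ennpow ?I (1 / s))"
      by (rule mult_left_mono) simp
    also have "\<dots> = ennreal (t * c powr (1 / s)) * ennpow ?I (1 / s)"
      using t by (simp add: ennreal_mult mult.assoc)
    also have "t * c powr (1 / s) = 2 * K powr (1 / s)"
      using t s by (simp add: c_def powr_mult powr_powr)
    also have "ennpow ?I (1 / s) = Lq_norm k w' s (\<lambda>x. ennreal (cmod (f x)))"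
      by (simp add: Lq_norm_def ennpow_ennreal)
    finally show "ennreal t * ennpow (emeasure (weight_measure k w) {x \<in> ktree k. ennreal t < maximal k f x}) (1 / s)
        \<le> ennreal (2 * K powr (1 / s)) * Lq_norm k w' s (\<lambda>x. ennreal (cmod (f x)))" .
  qed
  moreover have "0 < 2 * K powr (1 / s)" using K by simp
  ultimately show ?thesis by blast
qed

theorem theorem5p1:
  fixes k :: nat and p \<alpha> \<beta> :: real and u v :: "nat list \<Rightarrow> real"
  assumes "2 \<le> k" and "1 < p"
    and "is_weight k u" and "is_weight k v"
    and "0 < \<beta>" and "\<beta> < 1" and "\<beta> \<le> \<alpha>" and "\<alpha> < p"
    and "\<exists>C::real. \<forall>E F. \<forall>r::nat. finite E \<longrightarrow> E \<subseteq> ktree k \<longrightarrow> finite F \<longrightarrow> F \<subseteq> ktree k \<longrightarrow>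
           (\<Sum>x\<in>E. \<Sum>y\<in>{y\<in>F. tree_dist k x y = r}. u y)
             \<le> C * real k powr (real r * \<beta>) * (\<Sum>x\<in>E. v x) powr (\<alpha> / p) * (\<Sum>x\<in>F. u x) powr (1 - \<alpha> / p)"
  shows "(\<exists>C::real. 0 < C \<and> (\<forall>f :: nat list \<Rightarrow> complex.
             weak_Lq_norm k u (\<beta> / \<alpha> * p) (maximal k f)
               \<le> ennreal C * Lq_norm k v (\<beta> / \<alpha> * p) (\<lambda>x. ennreal (cmod (f x)))))
    \<and> (\<beta> < \<alpha> \<longrightarrow>
         (\<exists>C::real. 0 < C \<and> (\<forall>f :: nat list \<Rightarrow> complex.
             Lq_norm k u p (maximal k f)
               \<le> ennreal C * Lq_norm k v p (\<lambda>x. ennreal (cmod (f x)))))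
       \<and> (\<exists>C::real. 0 < C \<and> (\<forall>f :: nat list \<Rightarrow> complex.
             Lq_norm k (dual_weight v p) (p / (p - 1)) (maximal k f)
               \<le> ennreal C * Lq_norm k (dual_weight u p) (p / (p - 1)) (\<lambda>x. ennreal (cmod (f x))))))"
proof -
  obtain C :: real where C: "\<And>E F r. finite E \<Longrightarrow> E \<subseteq> ktree k \<Longrightarrow> finite F \<Longrightarrow> F \<subseteq> ktree k \<Longrightarrow>
      (\<Sum>x\<in>E. \<Sum>y\<in>{y\<in>F. tree_dist k x y = r}. u y)
        \<le> C * real k powr (real r * \<beta>) * (\<Sum>x\<in>E. v x) powr (\<alpha> / p) * (\<Sum>x\<in>F. u x) powr (1 - \<alpha> / p)"
    using assms(9) by blast
  \<comment> \<open>The given constant may have any sign. Enlarging it to \<open>max C 1\<close>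
    makes it positive and keeps the inequality, as the other factors are nonnegative.\<close>
  interpret spherical_condition k p \<alpha> \<beta> "max C 1" u v
  proof
    fix E F r assume "finite E" "E \<subseteq> ktree k" "finite F" "F \<subseteq> ktree k"
    from C[OF this, of r]
    show "(\<Sum>x\<in>E. \<Sum>y\<in>{y\<in>F. tree_dist k x y = r}. u y)
      \<le> max C 1 * real k powr (real r * \<beta>) * (\<Sum>x\<in>E. v x) powr (\<alpha> / p) * (\<Sum>x\<in>F. u x) powr (1 - \<alpha> / p)"
      by (rule order_trans) (intro mult_right_mono, auto)
  qed (use assms in auto)
  have weak: "\<exists>C::real. 0 < C \<and> (\<forall>f :: nat list \<Rightarrow> complex.
             weak_Lq_norm k u q (maximal k f) \<le> ennreal C * Lq_norm k v q (\<lambda>x. ennreal (cmod (f x))))"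
  proof (rule weak_type)
    fix K assume "0 < K" and *: "\<And>g l. (\<And>x. 0 \<le> g x) \<Longrightarrow> 0 < l \<Longrightarrow>
      emeasure (weight_measure k u) {x \<in> ktree k. \<exists>r. l < sphere_mean k r g x}
        \<le> ennreal K * (\<integral>\<^sup>+x. ennreal ((g x / l) powr q) \<partial>weight_measure k v)"
    then show ?thesis by (intro maximal_weak_type[OF k q_pos _ *]) auto
  qed
  have strong: "(\<exists>C::real. 0 < C \<and> (\<forall>f :: nat list \<Rightarrow> complex.
             Lq_norm k u p (maximal k f) \<le> ennreal C * Lq_norm k v p (\<lambda>x. ennreal (cmod (f x)))))
       \<and> (\<exists>C::real. 0 < C \<and> (\<forall>f :: nat list \<Rightarrow> complex.
             Lq_norm k (dual_weight v p) (p / (p - 1)) (maximal k f)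
               \<le> ennreal C * Lq_norm k (dual_weight u p) (p / (p - 1)) (\<lambda>x. ennreal (cmod (f x)))))"
    if "\<beta> < \<alpha>"
  proof (rule strong_type_sphere_mean[OF that])
    fix K \<delta> :: real
    assume K: "0 < K" and \<delta>: "0 < \<delta>" and *: "\<And>g r. (\<And>x. 0 \<le> g x) \<Longrightarrow>
      (\<integral>\<^sup>+x. ennreal (sphere_mean k r g x powr p) \<partial>weight_measure k u)
        \<le> ennreal (K * real k powr (- \<delta> * real r)) * (\<integral>\<^sup>+x. ennreal (g x powr p) \<partial>weight_measure k v)"
    \<comment> \<open>Duality is applied for each radius with
      \<open>N = K * k powr (- \<delta> * r)\<close>; the power \<open>1 / (p - 1)\<close> keeps the
      decay geometric, at rate \<open>\<delta> / (p - 1)\<close>.\<close>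
    have dual: "(\<integral>\<^sup>+x. ennreal (sphere_mean k r g x powr (p / (p - 1))) \<partial>weight_measure k (dual_weight v p))
        \<le> ennreal (K powr (1 / (p - 1)) * real k powr (- (\<delta> / (p - 1)) * real r)) *
          (\<integral>\<^sup>+x. ennreal (g x powr (p / (p - 1))) \<partial>weight_measure k (dual_weight u p))"
      if g: "\<And>x. 0 \<le> g x" for g r
    proof -
      have "0 < K * real k powr (- \<delta> * real r)" using K k by simp
      from sphere_mean_dual[OF p this u v * g]
      show ?thesis by (simp add: powr_mult powr_powr)
    qed
    show ?thesis
    proof
      show "\<exists>C::real. 0 < C \<and> (\<forall>f :: nat list \<Rightarrow> complex.
          Lq_norm k u p (maximal k f) \<le> ennreal C * Lq_norm k v p (\<lambda>x. ennreal (cmod (f x))))"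
        using p by (intro maximal_strong_type[OF k _ K \<delta> *]) auto
      show "\<exists>C::real. 0 < C \<and> (\<forall>f :: nat list \<Rightarrow> complex.
          Lq_norm k (dual_weight v p) (p / (p - 1)) (maximal k f)
            \<le> ennreal C * Lq_norm k (dual_weight u p) (p / (p - 1)) (\<lambda>x. ennreal (cmod (f x))))"
        using p K \<delta> by (intro maximal_strong_type[OF k _ _ _ dual]) auto
    qed
  qed
  from weak strong show ?thesis by blast
qed

end
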